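(* Let $f\in L^1(\mathbb{R}^2)$ and let $u$ be the harmonic (Poisson) extension of $f$ to $\mathbb{R}^3_+=\{(x,y):x\in\mathbb{R}^2,\ y>0\}$. For $\theta\in[0,2\pi)$, identified with the unit vector $(\cos\theta,\sin\theta)$, and $\Im z>0$ set $$F_\theta(z)=\int_0^\infty e^{2i\pi r z}\,\hat f(r\theta)\,r\,dr .$$ Then, as an equality in $[0,+\infty]$, $$\int_0^{2\pi}\|F_\theta\|_{\mathsf{H}^2(\mathbb{R})}^2\,d\theta=\frac1\pi\iint_{\mathbb{R}^3_+}\left|\frac{\partial u(x,y)}{\partial y}\right|^2dx\,dy .$$
   Context: The Fourier transform is $\hat f(\xi)=\int_{\mathbb{R}^2}f(x)e^{-2i\pi x\cdot\xi}\,dx$; $\hat f(r\theta)$ means $\hat f(r\cos\theta,r\sin\theta)$. The harmonic extension is $u(x,y)=(f\star\mathsf{P}_y)(x)=\int_{\mathbb{R}^2} e^{2i\pi x\cdot\xi}e^{-2\pi|\xi|y}\hat f(\xi)\,d\xi$, where $\mathsf{P}_y$ is the Poisson kernel. For $F$ analytic on the upper half plane, $\|F\|_{\mathsf{H}^2(\mathbb{R})}=\sup_{y>0}\|F(\cdot+iy)\|_{L^2(\mathbb{R})}\in[0,+\infty]$. *)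

theory Defs
  imports "HOL-Analysis.Analysis"
begin

definition fourier_transform :: "(real^2 \<Rightarrow> complex) \<Rightarrow> real^2 \<Rightarrow> complex" where
  "fourier_transform f \<xi> =
     (LINT x|lebesgue. f x * exp (- 2 * \<i> * of_real pi * of_real (x \<bullet> \<xi>)))"

text \<open>
  In dimension \<open>d\<close> the constant is \<open>\<Gamma> ((d + 1) / 2) / \<pi> powr ((d + 1) / 2)\<close>,
  which is \<open>1 / (2 * \<pi>)\<close> for \<open>d = 2\<close>.
\<close>

definition poisson_kernel :: "real \<Rightarrow> real^2 \<Rightarrow> real" where
  "poisson_kernel y x = y / (2 * pi * ((norm x)\<^sup>2 + y\<^sup>2) powr (3/2))"

definition poisson_extension :: "(real^2 \<Rightarrow> complex) \<Rightarrow> real^2 \<Rightarrow> real \<Rightarrow> complex" where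
  "poisson_extension f x y = (LINT t|lebesgue. f t * of_real (poisson_kernel y (x - t)))"

definition upper_half_space :: "((real^2) \<times> real) set" where
  "upper_half_space = {(x, y). y > 0}"

definition F_slice :: "(real^2 \<Rightarrow> complex) \<Rightarrow> real \<Rightarrow> complex \<Rightarrow> complex" where
  "F_slice f \<theta> z =
     (LBINT r:{0..}. exp (2 * \<i> * of_real pi * of_real r * z)
        * fourier_transform f (vector [r * cos \<theta>, r * sin \<theta>]) * of_real r)"

definition L2_enorm :: "(real \<Rightarrow> complex) \<Rightarrow> ennreal" where
  "L2_enorm g =
     (let I = \<integral>\<^sup>+ x. ennreal ((norm (g x))\<^sup>2) \<partial>lborel
      in if I = top then top else ennreal (sqrt (enn2real I)))"

text \<open>
  The norm is only meant for functions that are analytic on the upper half plane; it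
  depends on the values of \<open>F\<close> there and nowhere else.
\<close>

definition hardy2_norm :: "(complex \<Rightarrow> complex) \<Rightarrow> ennreal" where
  "hardy2_norm F = (SUP y\<in>{0<..}. L2_enorm (\<lambda>x. F (Complex x y)))"

end

(* By Plancherel on the line and in the plane, together with polar coordinates, both sides equal
   the integral of |xi| |fhat(xi)|^2 over the plane.  On the left, the L^2 norm of F_theta on the
   line Im z = y is the integral of r^2 exp(-4 pi r y) |fhat(r theta)|^2 over r > 0, which
   increases as y decreases to 0.  On the right, du/dy(., y) is the inverse Fourier transform of
   -2 pi |xi| exp(-2 pi |xi| y) fhat(xi), and the y-integral of (2 pi |xi|)^2 exp(-4 pi |xi| y)
   is pi |xi|.  All functions to which Plancherel is applied are continuous, bounded and
   integrable, so that damping by Gaussians and dominated convergence prove it.  The Fourier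
   representation of the Poisson kernel comes from writing the kernel as a mixture of Gaussians. *)

theory Submission
  imports Defs "HOL-Probability.Characteristic_Functions"
begin

subsection \<open>Gaussian integrals\<close>

text \<open>Both sides may be infinite: for integrable f the transform fhat is continuous and
  bounded, but |\<xi>| |fhat(\<xi>)|^2 need not be integrable over the plane. Plancherel and polar
  coordinates are therefore used only at heights y > 0, where the exponential factor supplies
  integrability. What remains is valid in [0, \<infinity>]: monotone convergence as y decreases to 0
  on the left, Tonelli in y on the right. Of the two factors r in |r fhat(r \<theta>)|^2 on the
  left, one is the Jacobian of polar coordinates and the other becomes |\<xi>|. The Poisson kernel
  is computed as the transform of the integrable function exp(-2 pi |\<xi>| y); Fubini then moves
  the transform onto f, so that no Fourier inversion is invoked. A second obstacle is that f is only
  Lebesgue measurable, while iterated integrals are taken over \<open>lborel\<close>; a Borel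
  representative of f bridges this.\<close>

lemma borel_measurable_cis [measurable (raw)]:
  "f \<in> borel_measurable M \<Longrightarrow> (\<lambda>x. cis (f x)) \<in> borel_measurable M"
  by (rule borel_measurable_continuous_on[where f=cis]) (auto intro: continuous_intros)

lemma borel_measurable_cnj [measurable (raw)]:
  "f \<in> borel_measurable M \<Longrightarrow> (\<lambda>x. cnj (f x)) \<in> borel_measurable M"
  by (rule borel_measurable_continuous_on[where f=cnj]) (auto intro: continuous_intros)

text \<open>A rescaled form of the characteristic function exp(-t^2/2) of the standard normal
  distribution.\<close>

lemma has_bochner_integral_gaussian_cis_real:
  fixes s w :: real
  assumes s: "s > 0"
  shows "has_bochner_integral lborel (\<lambda>x. of_real (exp (- pi * s * x\<^sup>2)) * cis (2 * pi * (w * x)))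
           (of_real (exp (- pi * w\<^sup>2 / s) / sqrt s))"
proof -
  \<comment> \<open>The scale \<open>c\<close> is fixed by (c x)^2 / 2 = pi s x^2, and then
    \<open>t\<close> by t (c x) = 2 pi w x.\<close>
  define c where "c = sqrt (2 * pi * s)"
  have c: "c > 0" "c\<^sup>2 = 2 * pi * s"
    using s by (auto simp: c_def)
  define t where "t = 2 * pi * w / c"
  have "(CLINT x|std_normal_distribution. iexp (t * x)) = of_real (exp (- (t\<^sup>2) / 2))"
    using char_std_normal_distribution unfolding char_def by metis
  then have "(LINT x|lborel. std_normal_density x *\<^sub>R iexp (t * x)) = of_real (exp (- (t\<^sup>2) / 2))"
    by (subst (asm) integral_density) auto
  moreover have "integrable lborel (\<lambda>x. std_normal_density x *\<^sub>R iexp (t * x))"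
    by (rule Bochner_Integration.integrable_bound[OF integrable_std_normal_moment[of 0]]) auto
  ultimately have "has_bochner_integral lborel (\<lambda>x. std_normal_density x *\<^sub>R iexp (t * x)) (of_real (exp (- (t\<^sup>2) / 2)))"
    by (simp add: has_bochner_integral_iff)
  then have "has_bochner_integral lborel (\<lambda>x. std_normal_density (0 + c * x) *\<^sub>R iexp (t * (0 + c * x)))
      (of_real (exp (- (t\<^sup>2) / 2)) /\<^sub>R \<bar>c\<bar>)"
    using c by (subst (asm) lborel_has_bochner_integral_real_affine_iff[where c=c and t=0]) auto
  from has_bochner_integral_scaleR_right[OF this, of "sqrt (2 * pi)"]
  have "has_bochner_integral lborel (\<lambda>x. sqrt (2 * pi) *\<^sub>R std_normal_density (c * x) *\<^sub>R iexp (t * (c * x)))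
      (sqrt (2 * pi) *\<^sub>R (of_real (exp (- (t\<^sup>2) / 2)) /\<^sub>R \<bar>c\<bar>))" by simp
  moreover have "sqrt (2 * pi) *\<^sub>R (std_normal_density (c * x) *\<^sub>R iexp (t * (c * x))) =
      of_real (exp (- pi * s * x\<^sup>2)) * cis (2 * pi * (w * x))" for x
  proof -
    have "t * (c * x) = 2 * pi * (w * x)" using c by (simp add: t_def)
    then have "iexp (t * (c * x)) = cis (2 * pi * (w * x))" by (simp only: cis_conv_exp)
    moreover have "(c * x)\<^sup>2 / 2 = pi * s * x\<^sup>2" using c by (simp add: power_mult_distrib)
    ultimately show ?thesis
      by (simp add: normal_density_def scaleR_conv_of_real mult_ac)
  qed
  moreover have "sqrt (2 * pi) *\<^sub>R (of_real (exp (- (t\<^sup>2) / 2)) /\<^sub>R \<bar>c\<bar>) = complex_of_real (exp (- pi * w\<^sup>2 / s) / sqrt s)"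
  proof -
    have "t\<^sup>2 / 2 = pi * w\<^sup>2 / s"
      using c s by (simp add: t_def power_divide power_mult_distrib) (simp add: power2_eq_square)
    moreover have "sqrt (2 * pi) / c = 1 / sqrt s"
      using s by (simp add: c_def real_sqrt_mult)
    ultimately show ?thesis using c
      by (simp add: scaleR_conv_of_real flip: of_real_mult of_real_divide of_real_inverse) (simp add: field_simps)
  qed
  ultimately show ?thesis by simp
qed

text \<open>\<open>lborel\<close> is the image of the product measure indexed by
  \<open>Basis\<close>, and under this map the integrand becomes a product of functions of single
  coordinates. This lifts the Gaussian integral from the line to every dimension; dimensions 1 and 2
  are needed.\<close>

lemma has_bochner_integral_lborel_prod:
  fixes f :: "'a::euclidean_space \<Rightarrow> real \<Rightarrow> complex"
  assumes f: "\<And>b. b \<in> Basis \<Longrightarrow> has_bochner_integral lborel (f b) (I b)"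
  shows "has_bochner_integral lborel (\<lambda>x::'a. \<Prod>b\<in>Basis. f b (x \<bullet> b)) (\<Prod>b\<in>Basis. I b)"
proof -
  interpret product_sigma_finite "\<lambda>_::'a. lborel :: real measure" ..
  have int: "\<And>b. b \<in> Basis \<Longrightarrow> integrable lborel (f b)" and val: "\<And>b. b \<in> Basis \<Longrightarrow> (LINT x|lborel. f b x) = I b"
    using f by (auto simp: has_bochner_integral_iff)
  have [measurable]: "\<And>b. b \<in> Basis \<Longrightarrow> f b \<in> borel_measurable borel"
    using int by (auto dest: borel_measurable_integrable)
  have lb: "lborel = distr (\<Pi>\<^sub>M b\<in>Basis. lborel) borel (\<lambda>f. \<Sum>b\<in>Basis. f b *\<^sub>R (b::'a))"
    by (simp add: lborel_def[where 'a='a] lborel_eq_real)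
  have eq: "(\<Prod>b\<in>Basis. f b ((\<Sum>b\<in>Basis. y b *\<^sub>R b) \<bullet> b)) = (\<Prod>b\<in>Basis. f b (y b))" for y :: "'a \<Rightarrow> real"
    by (intro prod.cong) auto
  have meas: "(\<lambda>x::'a. \<Prod>b\<in>Basis. f b (x \<bullet> b)) \<in> borel_measurable borel"
    by measurable
  have "integrable lborel (\<lambda>x::'a. \<Prod>b\<in>Basis. f b (x \<bullet> b))"
    using product_integrable_prod[of Basis f] int meas
    by (subst lb) (simp add: integrable_distr_eq eq)
  moreover have "(LINT x|lborel. (\<Prod>b\<in>Basis. f b ((x::'a) \<bullet> b))) = (\<Prod>b\<in>Basis. I b)"
    using product_integral_prod[of Basis f] int meas
    by (subst lb) (simp add: integral_distr eq val)
  ultimately show ?thesis by (simp add: has_bochner_integral_iff)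
qed

lemma has_bochner_integral_gaussian_cis:
  fixes w :: "'a::euclidean_space"
  assumes s: "s > 0"
  shows "has_bochner_integral lborel (\<lambda>x::'a. of_real (exp (- pi * s * (norm x)\<^sup>2)) * cis (2 * pi * (w \<bullet> x)))
           (of_real (exp (- pi * (norm w)\<^sup>2 / s) / sqrt s ^ DIM('a)))"
proof -
  have nrm: "(norm x)\<^sup>2 = (\<Sum>b\<in>Basis. (x \<bullet> b)\<^sup>2)" for x :: 'a
    by (subst power2_norm_eq_inner, subst euclidean_inner) (simp add: power2_eq_square)
  have cis_sum: "cis (sum g A) = (\<Prod>b\<in>A. cis (g b))" if "finite A" for g and A :: "'a set"
    using that by induction (auto simp flip: cis_mult)
  have "has_bochner_integral lborel (\<lambda>x::'a. \<Prod>b\<in>Basis. of_real (exp (- pi * s * (x \<bullet> b)\<^sup>2)) * cis (2 * pi * ((w \<bullet> b) * (x \<bullet> b))))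
          (\<Prod>b\<in>Basis. of_real (exp (- pi * (w \<bullet> b)\<^sup>2 / s) / sqrt s))"
    by (rule has_bochner_integral_lborel_prod, rule has_bochner_integral_gaussian_cis_real[OF s])
  moreover have "(\<Prod>b\<in>Basis. of_real (exp (- pi * s * (x \<bullet> b)\<^sup>2)) * cis (2 * pi * ((w \<bullet> b) * (x \<bullet> b))))
     = of_real (exp (- pi * s * (norm x)\<^sup>2)) * cis (2 * pi * (w \<bullet> x))" for x
    by (simp add: prod.distrib nrm euclidean_inner[of w x] sum_distrib_left exp_sum cis_sum)
  moreover have "(\<Prod>b\<in>Basis. of_real (exp (- pi * (w \<bullet> b)\<^sup>2 / s) / sqrt s)) =
      complex_of_real (exp (- pi * (norm w)\<^sup>2 / s) / sqrt s ^ DIM('a))"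
    by (simp add: nrm sum_distrib_left sum_divide_distrib prod_dividef)
       (simp add: sum_negf[symmetric] exp_sum)
  ultimately show ?thesis by simp
qed

subsection \<open>Plancherel's identity\<close>

text \<open>Justifies interchanges of integrals in which the variables are coupled only through
  factors of bounded modulus, so that a product of two integrable functions is a majorant.\<close>

lemma integrable_pair_bound:
  fixes p :: "'a::euclidean_space \<Rightarrow> real" and q :: "'b::euclidean_space \<Rightarrow> real"
    and h :: "'a \<times> 'b \<Rightarrow> complex"
  assumes p: "integrable lborel p" and q: "integrable lborel q"
    and h [measurable]: "h \<in> borel_measurable (lborel \<Otimes>\<^sub>M lborel)"
    and bound: "\<And>x y. norm (h (x, y)) \<le> p x * q y"
  shows "integrable (lborel \<Otimes>\<^sub>M lborel) h"
proof -
  have "integrable (lborel \<Otimes>\<^sub>M lborel) (\<lambda>z. p (fst z) * q (snd z))"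
  proof (rule lborel_pair.Fubini_integrable)
    show "(\<lambda>z. p (fst z) * q (snd z)) \<in> borel_measurable (lborel \<Otimes>\<^sub>M lborel)"
      using borel_measurable_integrable[OF p] borel_measurable_integrable[OF q] by measurable
    show "integrable lborel (\<lambda>x. LINT y|lborel. norm (p (fst (x, y)) * q (snd (x, y))))"
      using p by (simp add: abs_mult)
    show "AE x in lborel. integrable lborel (\<lambda>y. p (fst (x, y)) * q (snd (x, y)))"
      using q by simp
  qed
  then show ?thesis
  proof (rule Bochner_Integration.integrable_bound)
    show "AE z in lborel \<Otimes>\<^sub>M lborel. norm (h z) \<le> norm (p (fst z) * q (snd z))"
      by (intro AE_I2) (metis bound order_trans abs_ge_self real_norm_def prod.collapse)
  qed simp
qed

lemma integral_lborel_affine: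
  fixes f :: "'a::euclidean_space \<Rightarrow> complex"
  assumes c: "c \<noteq> 0" and [measurable]: "f \<in> borel_measurable borel"
  shows "(LINT x|lborel. f x) = \<bar>c\<bar> ^ DIM('a) *\<^sub>R (LINT x|lborel. f (t + c *\<^sub>R x))"
proof -
  have "(LINT x|lborel. f x) = (LINT x|density (distr lborel borel (\<lambda>x. t + c *\<^sub>R x)) (\<lambda>_. \<bar>c\<bar> ^ DIM('a)). f x)"
    using lborel_affine[OF c, of t] by simp
  also have "\<dots> = \<bar>c\<bar> ^ DIM('a) *\<^sub>R (LINT x|lborel. f (t + c *\<^sub>R x))"
    by (subst integral_density) (auto simp: integral_distr)
  finally show ?thesis .
qed

text \<open>Dominated convergence with majorant \<open>norm (g t)\<close>, because characters have
  modulus 1. It gives the measurability of the transform in Plancherel's identity and later the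
  continuity of \<open>fourier_transform f\<close>.\<close>

lemma continuous_on_integral_cis:
  fixes g :: "'a::euclidean_space \<Rightarrow> complex"
  assumes g: "integrable lborel g"
  shows "continuous_on UNIV (\<lambda>x. LINT t|lborel. g t * cis (2 * pi * (x \<bullet> t)))"
  unfolding continuous_on_sequentially comp_def
proof (intro allI ballI impI)
  fix X and a :: 'a assume "(\<forall>n. X n \<in> UNIV) \<and> X \<longlonglongrightarrow> a"
  then have X: "X \<longlonglongrightarrow> a" by simp
  have [measurable]: "g \<in> borel_measurable borel" using g by auto
  show "(\<lambda>n. LINT t|lborel. g t * cis (2 * pi * (X n \<bullet> t))) \<longlonglongrightarrow> (LINT t|lborel. g t * cis (2 * pi * (a \<bullet> t)))"
  proof (rule integral_dominated_convergence[where w="\<lambda>t. norm (g t)"])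
    have *: "(\<lambda>n. cis (2 * pi * (X n \<bullet> t))) \<longlonglongrightarrow> cis (2 * pi * (a \<bullet> t))" for t
      by (rule isCont_tendsto_compose[of _ cis])
         (auto intro!: tendsto_intros X continuous_on_interior[of UNIV cis] continuous_intros)
    show "AE t in lborel. (\<lambda>n. g t * cis (2 * pi * (X n \<bullet> t))) \<longlonglongrightarrow> g t * cis (2 * pi * (a \<bullet> t))"
      by (intro AE_I2 tendsto_intros *)
  qed (use g in \<open>auto simp: norm_mult\<close>)
qed

lemma integrable_gaussian:
  assumes "s > 0"
  shows "integrable lborel (\<lambda>x::'a::euclidean_space. exp (- (pi * s * (norm x)\<^sup>2)))"
proof -
  have "integrable lborel (\<lambda>x::'a. complex_of_real (exp (- (pi * s * (norm x)\<^sup>2))))"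
    using has_bochner_integral_gaussian_cis[OF assms, of "0::'a"] by (auto simp: has_bochner_integral_iff)
  then show ?thesis by (simp only: complex_of_real_integrable_eq)
qed

text \<open>Continuity of \<open>g\<close> makes the Gaussian averages \<open>K n\<close> converge
  to \<open>g\<close> at every point, not just almost everywhere. Boundedness dominates these
  averages and makes \<open>g\<close> square integrable.\<close>

theorem plancherel:
  fixes g :: "'a::euclidean_space \<Rightarrow> complex"
  assumes g: "integrable lborel g" and cont: "continuous_on UNIV g" and bdd: "\<And>x. norm (g x) \<le> B"
  shows "(\<integral>\<^sup>+x. ennreal ((norm (LINT t|lborel. g t * cis (2 * pi * (x \<bullet> t))))\<^sup>2) \<partial>lborel)
       = (\<integral>\<^sup>+t. ennreal ((norm (g t))\<^sup>2) \<partial>lborel)"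
proof -
  define G where "G x = (LINT t|lborel. g t * cis (2 * pi * (x \<bullet> t)))" for x
  define N where "N = (LINT t|lborel. norm (g t))"
  define d where "d n = 1 / real (Suc n)" for n
  define E where "E n x = exp (- (pi * (d n)\<^sup>2 * (norm x)\<^sup>2))" for n and x :: 'a
  define K where "K n t = (LINT v|lborel. exp (- (pi * (norm v)\<^sup>2)) * g (t + d n *\<^sub>R v))" for n t
  have d0: "d n > 0" for n by (simp add: d_def)
  have dlim: "d \<longlonglongrightarrow> 0"
    unfolding d_def by (rule lim_1_over_n[THEN LIMSEQ_Suc])
  have [measurable]: "g \<in> borel_measurable borel" using g by auto
  have [measurable]: "G \<in> borel_measurable borel"
    unfolding G_def using continuous_on_integral_cis[OF g] by (rule borel_measurable_continuous_onI)
  have [measurable]: "E n \<in> borel_measurable borel" for n unfolding E_def by measurable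
  have GN: "norm (G x) \<le> N" for x
    unfolding G_def N_def by (rule order_trans[OF integral_norm_bound]) (simp add: norm_mult)
  have N0: "N \<ge> 0" unfolding N_def by simp
  have Eint: "integrable lborel (E n)" for n
    unfolding E_def using integrable_gaussian[of "(d n)\<^sup>2"] d0[of n] by simp
  have E0: "E n x > 0" for n x by (simp add: E_def)
  \<comment> \<open>Damping by \<open>E n\<close> on the Fourier side is convolution with a Gaussian of width \<open>d n\<close>, so the
    damped squared norm of \<open>G\<close> tends to the squared norm of \<open>g\<close>.\<close>
  have inner: "(LINT x|lborel. E n x * G x * cis (- (2 * pi * (x \<bullet> t)))) = K n t" for n t
  proof -
    have "(LINT x|lborel. E n x * G x * cis (- (2 * pi * (x \<bullet> t)))) =
          (LINT x|lborel. LINT s|lborel. E n x * g s * cis (2 * pi * (x \<bullet> (s - t))))"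
    proof (rule Bochner_Integration.integral_cong[OF refl])
      fix x
      have "E n x * G x * cis (- (2 * pi * (x \<bullet> t))) = (LINT s|lborel. (E n x * cis (- (2 * pi * (x \<bullet> t)))) * (g s * cis (2 * pi * (x \<bullet> s))))"
        unfolding G_def by (subst integral_mult_right_zero) simp
      also have "\<dots> = (LINT s|lborel. E n x * g s * cis (2 * pi * (x \<bullet> (s - t))))"
        by (intro Bochner_Integration.integral_cong refl)
           (simp add: inner_diff_right right_diff_distrib mult_ac flip: cis_divide cis_inverse divide_inverse)
      finally show "E n x * G x * cis (- (2 * pi * (x \<bullet> t))) = (LINT s|lborel. E n x * g s * cis (2 * pi * (x \<bullet> (s - t))))" .
    qed
    also have "\<dots> = (LINT s|lborel. LINT x|lborel. E n x * g s * cis (2 * pi * (x \<bullet> (s - t))))"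
      by (rule lborel_pair.Fubini_integral[symmetric], rule integrable_pair_bound[OF Eint integrable_norm[OF g]])
         (use E0[THEN less_imp_le] in \<open>auto simp: norm_mult\<close>)
    also have "\<dots> = (LINT s|lborel. g s * (exp (- pi * (norm (s - t))\<^sup>2 / (d n)\<^sup>2) / d n ^ DIM('a)))"
    proof (rule Bochner_Integration.integral_cong[OF refl])
      fix s
      have "(LINT x|lborel. E n x * g s * cis (2 * pi * (x \<bullet> (s - t)))) =
            (LINT x|lborel. g s * (of_real (exp (- pi * (d n)\<^sup>2 * (norm x)\<^sup>2)) * cis (2 * pi * ((s - t) \<bullet> x))))"
        by (intro Bochner_Integration.integral_cong refl) (simp add: E_def inner_commute mult_ac)
      also have "\<dots> = g s * (exp (- pi * (norm (s - t))\<^sup>2 / (d n)\<^sup>2) / sqrt ((d n)\<^sup>2) ^ DIM('a))"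
        using has_bochner_integral_gaussian_cis[of "(d n)\<^sup>2" "s - t"] d0[of n]
        by (subst integral_mult_right_zero) (simp add: has_bochner_integral_iff)
      finally show "(LINT x|lborel. E n x * g s * cis (2 * pi * (x \<bullet> (s - t)))) = g s * (exp (- pi * (norm (s - t))\<^sup>2 / (d n)\<^sup>2) / d n ^ DIM('a))"
        using d0[of n] by simp
    qed
    \<comment> \<open>In the substitution s = t + d n v the Jacobian cancels the normalisation of
      the Gaussian, which acquires width 1; \<open>K n t\<close> thus averages \<open>g\<close> at
      distances of order \<open>d n\<close> from \<open>t\<close>.\<close>
    also have "\<dots> = d n ^ DIM('a) *\<^sub>R (LINT v|lborel. g (t + d n *\<^sub>R v) * (exp (- pi * (norm (t + d n *\<^sub>R v - t))\<^sup>2 / (d n)\<^sup>2) / d n ^ DIM('a)))"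
      using d0[of n] by (subst integral_lborel_affine[where c="d n" and t=t]) auto
    also have "\<dots> = (LINT v|lborel. d n ^ DIM('a) *\<^sub>R (g (t + d n *\<^sub>R v) * (exp (- pi * (norm (t + d n *\<^sub>R v - t))\<^sup>2 / (d n)\<^sup>2) / d n ^ DIM('a))))"
      unfolding scaleR_conv_of_real by (rule integral_mult_right_zero[symmetric])
    also have "\<dots> = K n t"
      unfolding K_def using d0[of n]
      by (intro Bochner_Integration.integral_cong refl) (simp add: scaleR_conv_of_real power_mult_distrib)
    finally show ?thesis .
  qed
  have step: "(LINT x|lborel. E n x * (norm (G x))\<^sup>2) = (LINT t|lborel. cnj (g t) * K n t)" for n
  proof -
    \<comment> \<open>Only the conjugate factor of |G|^2 = G * cnj G is expanded, so that after the
      interchange the integral in x is the one computed in \<open>inner\<close>.\<close>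
    have cnjG: "cnj (G x) = (LINT t|lborel. cnj (g t) * cis (- (2 * pi * (x \<bullet> t))))" for x
      using Bochner_Integration.integral_cnj[of lborel "\<lambda>t. g t * cis (2 * pi * (x \<bullet> t))"] by (simp add: G_def cis_cnj)
    have "complex_of_real (LINT x|lborel. E n x * (norm (G x))\<^sup>2) = (LINT x|lborel. E n x * G x * cnj (G x))"
      by (simp add: complex_norm_square[unfolded of_real_power] mult.assoc flip: integral_complex_of_real)
    also have "\<dots> = (LINT x|lborel. LINT t|lborel. E n x * G x * (cnj (g t) * cis (- (2 * pi * (x \<bullet> t)))))"
      by (simp only: integral_mult_right_zero cnjG)
    also have "\<dots> = (LINT t|lborel. LINT x|lborel. E n x * G x * (cnj (g t) * cis (- (2 * pi * (x \<bullet> t)))))"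
    proof (rule lborel_pair.Fubini_integral[symmetric], rule integrable_pair_bound[OF integrable_mult_right[OF Eint[of n], of N] integrable_norm[OF g]])
      fix x t
      show "norm (case (x, t) of (x, t) \<Rightarrow> E n x * G x * (cnj (g t) * cis (- (2 * pi * (x \<bullet> t))))) \<le> N * E n x * norm (g t)"
        using mult_right_mono[OF GN[of x], of "E n x * norm (g t)"] E0[of n x]
        by (simp add: norm_mult mult_ac)
    qed measurable
    also have "\<dots> = (LINT t|lborel. LINT x|lborel. cnj (g t) * (E n x * G x * cis (- (2 * pi * (x \<bullet> t)))))"
      by (simp add: mult_ac)
    also have "\<dots> = (LINT t|lborel. cnj (g t) * K n t)"
      by (simp add: inner integral_mult_right_zero)
    finally show ?thesis .
  qed
  have gauss1: "integrable lborel (\<lambda>v::'a. exp (- (pi * (norm v)\<^sup>2)))"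
       and gauss1_val: "(LINT v|lborel. of_real (exp (- (pi * (norm (v::'a))\<^sup>2)))) = (1::complex)"
    using integrable_gaussian[of 1, where 'a='a] has_bochner_integral_gaussian_cis[of 1 "0::'a"]
    by (auto simp: has_bochner_integral_iff)
  have gauss1_val': "(LINT v|lborel. exp (- (pi * (norm (v::'a))\<^sup>2))) = 1"
    using gauss1_val unfolding integral_complex_of_real by (simp only: of_real_eq_1_iff)
  have B0: "B \<ge> 0" using bdd[of 0] norm_ge_zero order_trans by blast
  have KB: "norm (K n t) \<le> B" for n t
  proof -
    have "norm (K n t) \<le> (LINT v|lborel. norm (exp (- (pi * (norm v)\<^sup>2)) * g (t + d n *\<^sub>R v)))"
      unfolding K_def by (rule integral_norm_bound)
    also have "\<dots> \<le> (LINT v|lborel. exp (- (pi * (norm (v::'a))\<^sup>2)) * B)"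
    proof (rule integral_mono)
      show 1: "integrable lborel (\<lambda>v::'a. exp (- (pi * (norm v)\<^sup>2)) * B)" using gauss1 by simp
      show "integrable lborel (\<lambda>v::'a. norm (exp (- (pi * (norm v)\<^sup>2)) * g (t + d n *\<^sub>R v)))"
        by (rule Bochner_Integration.integrable_bound[OF 1]) (use bdd B0 in \<open>auto simp: norm_mult abs_mult\<close>)
    qed (use bdd in \<open>simp add: norm_mult\<close>)
    also have "\<dots> = B" by (simp add: gauss1_val')
    finally show ?thesis .
  qed
  have Klim: "(\<lambda>n. K n t) \<longlonglongrightarrow> g t" for t
  proof -
    have "(\<lambda>n. K n t) \<longlonglongrightarrow> (LINT v|lborel. of_real (exp (- (pi * (norm (v::'a))\<^sup>2))) * g t)"
      unfolding K_def
    proof (rule integral_dominated_convergence[where w="\<lambda>v. exp (- (pi * (norm (v::'a))\<^sup>2)) * B"])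
      have *: "(\<lambda>n. g (t + d n *\<^sub>R v)) \<longlonglongrightarrow> g t" for v
        by (rule isCont_tendsto_compose[of _ g])
           (use cont in \<open>auto intro!: tendsto_eq_intros dlim simp: continuous_on_eq_continuous_at\<close>)
      show "AE v in lborel. (\<lambda>n. exp (- (pi * (norm v)\<^sup>2)) * g (t + d n *\<^sub>R v)) \<longlonglongrightarrow> exp (- (pi * (norm (v::'a))\<^sup>2)) * g t"
        by (intro AE_I2 tendsto_intros *)
    qed (use gauss1 bdd in \<open>auto simp: norm_mult\<close>)
    then show ?thesis by (simp add: gauss1_val')
  qed
  have [measurable]: "K n \<in> borel_measurable borel" for n
    unfolding K_def by measurable
  have lim1: "(\<lambda>n. LINT t|lborel. cnj (g t) * K n t) \<longlonglongrightarrow> (LINT t|lborel. cnj (g t) * g t)"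
    by (rule integral_dominated_convergence[where w="\<lambda>t. norm (g t) * B"])
       (use g KB in \<open>auto simp: norm_mult intro!: tendsto_intros Klim mult_left_mono\<close>)
  have gsq: "integrable lborel (\<lambda>t. (norm (g t))\<^sup>2)"
    by (rule Bochner_Integration.integrable_bound[OF integrable_mult_right[OF integrable_norm[OF g], of B]])
       (use bdd in \<open>auto simp: power2_eq_square abs_mult intro!: mult_right_mono order_trans[OF bdd abs_ge_self]\<close>)
  have "(LINT t|lborel. cnj (g t) * g t) = complex_of_real (LINT t|lborel. (norm (g t))\<^sup>2)"
    by (simp add: complex_norm_square[unfolded of_real_power] mult.commute flip: integral_complex_of_real)
  with lim1 step have "(\<lambda>n. complex_of_real (LINT x|lborel. E n x * (norm (G x))\<^sup>2)) \<longlonglongrightarrow> complex_of_real (LINT t|lborel. (norm (g t))\<^sup>2)"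
    by simp
  then have "(\<lambda>n. LINT x|lborel. E n x * (norm (G x))\<^sup>2) \<longlonglongrightarrow> (LINT t|lborel. (norm (g t))\<^sup>2)"
    by (simp only: tendsto_of_real_iff)
  then have lim2: "(\<lambda>n. ennreal (LINT x|lborel. E n x * (norm (G x))\<^sup>2)) \<longlonglongrightarrow> ennreal (LINT t|lborel. (norm (g t))\<^sup>2)"
    by (rule tendsto_ennrealI)
  have EGint: "integrable lborel (\<lambda>x. E n x * (norm (G x))\<^sup>2)" for n
    by (rule Bochner_Integration.integrable_bound[OF integrable_mult_right[OF Eint[of n], of "N\<^sup>2"]])
       (use E0[THEN less_imp_le] in \<open>auto simp: abs_mult mult.commute[of "N\<^sup>2"] intro!: mult_left_mono power_mono GN\<close>)
  \<comment> \<open>Square integrability of \<open>G\<close> is not known at this point, so the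
    damping is removed by monotone convergence: \<open>E n\<close> increases to 1 as
    \<open>d n\<close> decreases to 0.\<close>
  have "(\<lambda>n. \<integral>\<^sup>+x. ennreal (E n x * (norm (G x))\<^sup>2) \<partial>lborel) \<longlonglongrightarrow> (\<integral>\<^sup>+x. ennreal ((norm (G x))\<^sup>2) \<partial>lborel)"
  proof (rule nn_integral_LIMSEQ)
    have "E m x \<le> E n x" if "m \<le> n" for m n x
      unfolding E_def using that d0[THEN less_imp_le]
      by (auto intro!: mult_right_mono mult_left_mono power_mono simp: d_def frac_le)
    then show "incseq (\<lambda>n x. ennreal (E n x * (norm (G x))\<^sup>2))"
      by (auto simp: incseq_def le_fun_def intro!: ennreal_leI mult_right_mono)
    have "(\<lambda>n. E n x * (norm (G x))\<^sup>2) \<longlonglongrightarrow> exp (- (pi * 0\<^sup>2 * (norm x)\<^sup>2)) * (norm (G x))\<^sup>2" for x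
      unfolding E_def by (intro tendsto_intros dlim)
    then show "(\<lambda>n. ennreal (E n x * (norm (G x))\<^sup>2)) \<longlonglongrightarrow> ennreal ((norm (G x))\<^sup>2)" for x
      by (intro tendsto_ennrealI) simp
  qed measurable
  moreover have "(\<integral>\<^sup>+x. ennreal (E n x * (norm (G x))\<^sup>2) \<partial>lborel) = ennreal (LINT x|lborel. E n x * (norm (G x))\<^sup>2)" for n
    by (rule nn_integral_eq_integral[OF EGint]) (use E0[THEN less_imp_le] in auto)
  ultimately have "(\<integral>\<^sup>+x. ennreal ((norm (G x))\<^sup>2) \<partial>lborel) = ennreal (LINT t|lborel. (norm (g t))\<^sup>2)"
    using lim2 LIMSEQ_unique by simp
  also have "\<dots> = (\<integral>\<^sup>+t. ennreal ((norm (g t))\<^sup>2) \<partial>lborel)"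
    by (rule nn_integral_eq_integral[OF gsq, symmetric]) auto
  finally show ?thesis unfolding G_def .
qed

subsection \<open>The Poisson kernel\<close>

text \<open>A subordination formula: for fixed t the integrand is a Gaussian in \<rho>, so
  exponential decay in \<rho> becomes an average of Gaussians, whose transforms in the plane are
  known.\<close>

lemma has_bochner_integral_cauchy_schloemilch:
  fixes y \<rho> :: real
  assumes y: "y > 0" and \<rho>: "\<rho> > 0"
  shows "has_bochner_integral lborel (\<lambda>t. y * exp (- pi * ((t * y)\<^sup>2 + (\<rho> / t)\<^sup>2))) (exp (- (2 * pi * \<rho> * y)))"
proof -
  \<comment> \<open>Substituting \<open>v = t * y - \<rho> / t\<close> turns the integral of \<open>(y + \<rho> / t\<^sup>2) * h t\<close> into a Gaussian one;
    the involution \<open>t \<mapsto> \<rho> / (y * t)\<close> preserves \<open>h\<close> and shows that the two summands contribute equally.\<close>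
  define h where "h t = exp (- (pi * (t * y - \<rho> / t)\<^sup>2))" for t
  define S where "S = {0::real<..}"
  have S: "S \<in> sets lebesgue" by (simp add: S_def)
  have gauss: "(\<lambda>v::real. exp (- (pi * v\<^sup>2))) absolutely_integrable_on UNIV \<and> integral UNIV (\<lambda>v::real. exp (- (pi * v\<^sup>2))) = 1"
  proof -
    have "has_bochner_integral lborel (\<lambda>v::real. complex_of_real (exp (- (pi * v\<^sup>2)))) (complex_of_real 1)"
      using has_bochner_integral_gaussian_cis_real[of 1 0] by simp
    then have 1: "integrable lborel (\<lambda>v::real. exp (- (pi * v\<^sup>2)))" "(LINT v|lborel. exp (- (pi * (v::real)\<^sup>2))) = 1"
      by (simp_all only: has_bochner_integral_iff complex_of_real_integrable_eq integral_complex_of_real of_real_eq_iff)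
    show ?thesis
      using 1 by (auto simp: set_integrable_def integrable_completion integral_lborel)
  qed
  have imv: "(\<lambda>t. t * y - \<rho> / t) ` S = UNIV"
  proof (intro equalityI subsetI)
    fix v :: real
    \<comment> \<open>For the preimage of v take the positive root t of y t^2 - v t - \<rho> = 0,
      whose discriminant is D^2.\<close>
    define D where "D = sqrt (v\<^sup>2 + 4 * \<rho> * y)"
    have D: "D\<^sup>2 = v\<^sup>2 + 4 * \<rho> * y" "D > \<bar>v\<bar>"
      using y \<rho> by (auto simp: D_def intro!: real_less_rsqrt)
    define t where "t = (v + D) / (2 * y)"
    have t: "t > 0" using D y by (auto simp: t_def)
    have "(v + D) * (D - v) = 4 * \<rho> * y" using D(1) by (simp add: algebra_simps power2_eq_square)
    then have "\<rho> / t = (D - v) / 2"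
      using y D by (simp add: t_def field_simps)
    moreover have "t * y = (v + D) / 2" using y by (simp add: t_def)
    ultimately have "t * y - \<rho> / t = (v + D) / 2 - (D - v) / 2" by (simp only:)
    then have "v = t * y - \<rho> / t" by (simp only:) (simp add: field_simps)
    then show "v \<in> (\<lambda>t. t * y - \<rho> / t) ` S" using t by (auto simp: S_def)
  qed auto
  have injv: "inj_on (\<lambda>t. t * y - \<rho> / t) S"
  proof (rule strict_mono_on_imp_inj_on, rule strict_mono_onI)
    fix a b assume "a \<in> S" "b \<in> S" "a < b"
    then have "a * y < b * y" "\<rho> / b < \<rho> / a" using y \<rho> by (auto simp: S_def divide_strict_left_mono)
    then show "a * y - \<rho> / a < b * y - \<rho> / b" by linarith
  qed
  have cv1: "(\<lambda>t. \<bar>y + \<rho> / t\<^sup>2\<bar> * h t) absolutely_integrable_on S \<and> integral S (\<lambda>t. \<bar>y + \<rho> / t\<^sup>2\<bar> * h t) = 1"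
    unfolding h_def
  proof (rule has_absolute_integral_change_of_variables_1'
      [where f="\<lambda>v. exp (- (pi * v\<^sup>2))" and g'="\<lambda>t. y + \<rho> / t\<^sup>2", THEN iffD2, OF S _ injv])
    show "((\<lambda>t. t * y - \<rho> / t) has_field_derivative y + \<rho> / t\<^sup>2) (at t within S)" if "t \<in> S" for t
      using that by (auto simp: S_def power2_eq_square intro!: derivative_eq_intros)
  qed (use gauss imv in simp)
  have hm: "h \<in> borel_measurable borel" unfolding h_def by measurable
  have int1: "(\<lambda>t. y * h t) absolutely_integrable_on S"
    using cv1[THEN conjunct1]
    by (rule set_integrable_bound) (use y \<rho> hm in \<open>auto simp: set_borel_measurable_def h_def S_def abs_mult intro!: mult_right_mono measurable_completion\<close>)
  have im2: "(\<lambda>t. \<rho> / (y * t)) ` S = S"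
  proof (intro equalityI subsetI)
    fix t assume "t \<in> S"
    then show "t \<in> (\<lambda>t. \<rho> / (y * t)) ` S"
      using y \<rho> by (intro image_eqI[of _ _ "\<rho> / (y * t)"]) (auto simp: S_def)
  qed (use y \<rho> in \<open>auto simp: S_def\<close>)
  have cv2: "(\<lambda>t. \<bar>- \<rho> / (y * t\<^sup>2)\<bar> * (y * h (\<rho> / (y * t)))) absolutely_integrable_on S \<and>
       integral S (\<lambda>t. \<bar>- \<rho> / (y * t\<^sup>2)\<bar> * (y * h (\<rho> / (y * t)))) = integral S (\<lambda>t. y * h t)"
  proof (rule has_absolute_integral_change_of_variables_1'
      [where f="\<lambda>t. y * h t" and g="\<lambda>t. \<rho> / (y * t)" and g'="\<lambda>t. - \<rho> / (y * t\<^sup>2)", THEN iffD2, OF S])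
    show "((\<lambda>t. \<rho> / (y * t)) has_field_derivative - \<rho> / (y * t\<^sup>2)) (at t within S)" if "t \<in> S" for t
      using that y by (auto simp: S_def power2_eq_square field_simps intro!: derivative_eq_intros)
  qed (use int1 im2 y \<rho> in \<open>auto simp: S_def inj_on_def\<close>)
  have eq2: "\<bar>- \<rho> / (y * t\<^sup>2)\<bar> * (y * h (\<rho> / (y * t))) = \<rho> / t\<^sup>2 * h t" if "t \<in> S" for t
  proof -
    have "\<rho> / (y * t) * y - \<rho> / (\<rho> / (y * t)) = - (t * y - \<rho> / t)"
      using that y \<rho> by (simp add: S_def field_simps)
    then have "h (\<rho> / (y * t)) = h t" unfolding h_def by (simp only: power2_minus)
    then show ?thesis using that y \<rho> by (simp add: S_def)
  qed
  have int2: "(\<lambda>t. \<rho> / t\<^sup>2 * h t) absolutely_integrable_on S" 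
    and eqint: "integral S (\<lambda>t. \<rho> / t\<^sup>2 * h t) = integral S (\<lambda>t. y * h t)"
    using cv2 eq2 by (auto cong: set_integrable_cong Henstock_Kurzweil_Integration.integral_cong)
  have "1 = integral S (\<lambda>t. y * h t + \<rho> / t\<^sup>2 * h t)"
    using cv1[THEN conjunct2] y \<rho>
    by (auto simp: S_def ring_distribs cong: Henstock_Kurzweil_Integration.integral_cong)
  also have "\<dots> = integral S (\<lambda>t. y * h t) + integral S (\<lambda>t. \<rho> / t\<^sup>2 * h t)"
    using int1 int2 by (intro Henstock_Kurzweil_Integration.integral_add set_lebesgue_integral_eq_integral)
  finally have half: "integral S (\<lambda>t. y * h t) = 1 / 2" using eqint by simp
  have "has_bochner_integral lborel (\<lambda>t. indicator S t *\<^sub>R (y * h t)) (1 / 2)"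
    using int1 half set_lebesgue_integral_eq_integral(2)[OF int1] hm
    unfolding set_integrable_def set_lebesgue_integral_def has_bochner_integral_iff
    by (subst (asm) integrable_completion, simp add: S_def, subst (asm) integral_completion) (auto simp: S_def)
  \<comment> \<open>For t \<noteq> 0, (t y)^2 + (\<rho>/t)^2 = (t y - \<rho>/t)^2 + 2 \<rho> y; the
    cross term is the source of this factor.\<close>
  from has_bochner_integral_mult_right[OF this, of "exp (- (2 * pi * \<rho> * y))"]
  have "has_bochner_integral lborel (\<lambda>t. exp (- (2 * pi * \<rho> * y)) * (indicator S t *\<^sub>R (y * h t))) (exp (- (2 * pi * \<rho> * y)) / 2)"
    by simp
  moreover have "AE t in lborel. exp (- (2 * pi * \<rho> * y)) * (indicator S t *\<^sub>R (y * h t)) =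
     indicator {0..} t *\<^sub>R (y * exp (- pi * ((t * y)\<^sup>2 + (\<rho> / t)\<^sup>2)))"
    using AE_lborel_singleton[of "0::real"]
  proof eventually_elim
    case (elim t)
    have "exp (- (2 * pi * \<rho> * y)) * h t = exp (- pi * ((t * y)\<^sup>2 + (\<rho> / t)\<^sup>2))"
      unfolding h_def exp_add[symmetric] using elim by (simp add: power2_diff algebra_simps)
    then show ?case using elim by (auto simp: S_def indicator_def mult_ac)
  qed
  ultimately have "has_bochner_integral lborel (\<lambda>t. indicator {0..} t *\<^sub>R (y * exp (- pi * ((t * y)\<^sup>2 + (\<rho> / t)\<^sup>2)))) (exp (- (2 * pi * \<rho> * y)) / 2)"
    using hm by (subst (asm) has_bochner_integral_cong_AE) (auto simp: S_def)
  \<comment> \<open>The integrand is even in t, so passing to the whole line doubles the value and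
    cancels the 1/2. The rule integrates over the closed half-line, which is why the point 0 was
    added just before.\<close>
  from has_bochner_integral_even_function[OF this] show ?thesis by simp
qed

text \<open>R exp(-pi (t R)^2) is the centred normal density of variance 1 / (2 pi R^2), and the
  integral is y / R times its second moment.\<close>

lemma has_bochner_integral_gaussian_square:
  fixes R y :: real
  assumes "R > 0"
  shows "has_bochner_integral lborel (\<lambda>t. y * t\<^sup>2 * exp (- (pi * (t * R)\<^sup>2))) (y / (2 * pi * R ^ 3))"
proof -
  define \<sigma> where "\<sigma> = 1 / (R * sqrt (2 * pi))"
  have \<sigma>: "\<sigma> > 0" "2 * pi * \<sigma>\<^sup>2 = 1 / R\<^sup>2" "\<sigma>\<^sup>2 = 1 / (2 * pi * R\<^sup>2)"
    using assms by (auto simp: \<sigma>_def power_mult_distrib power_divide)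
  have d: "normal_density 0 \<sigma> t = R * exp (- (pi * (t * R)\<^sup>2))" for t
    using assms by (simp add: normal_density_def \<sigma> real_sqrt_divide power_mult_distrib)
  have "has_bochner_integral lborel (\<lambda>t. normal_density 0 \<sigma> t * (t - 0) ^ (2 * 1)) (fact (2 * 1) / ((2 / \<sigma>\<^sup>2) ^ 1 * fact 1))"
    by (rule normal_moment_even[OF \<sigma>(1)])
  then have "has_bochner_integral lborel (\<lambda>t. R * exp (- (pi * (t * R)\<^sup>2)) * t\<^sup>2) (1 / (2 * pi * R\<^sup>2))"
    unfolding d \<sigma>(3) by (simp add: mult.assoc)
  from has_bochner_integral_mult_right[OF this, of "y / R"] show ?thesis
    using assms by (simp add: power2_eq_square power3_eq_cube mult_ac)
qed

lemma poisson_kernel_integrals: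
  fixes x :: "real^2"
  assumes y: "y > 0"
  shows integrable_exp_norm_cis: "integrable lborel (\<lambda>\<xi>::real^2. of_real (exp (- (2 * pi * norm \<xi> * y))) * cis (2 * pi * (x \<bullet> \<xi>)))"
    and poisson_kernel_eq: "of_real (poisson_kernel y x) = (LINT \<xi>|lborel. of_real (exp (- (2 * pi * norm \<xi> * y))) * cis (2 * pi * (x \<bullet> \<xi>)))"
proof -
  \<comment> \<open>Integrating \<open>H\<close> over \<open>\<xi>\<close> first gives a Gaussian mixture equal to the Poisson kernel,
    integrating over \<open>t\<close> first gives its Fourier transform. At \<open>t = 0\<close>, where
    \<open>norm \<xi> / 0 = 0\<close>, \<open>H\<close> is not integrable in \<open>\<xi>\<close>, hence the null sets below.\<close>
  define H where "H t \<xi> = of_real (y * exp (- pi * ((t * y)\<^sup>2 + (norm \<xi> / t)\<^sup>2))) * cis (2 * pi * (x \<bullet> \<xi>))" for t :: real and \<xi> :: "real^2"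
  define R where "R = sqrt ((norm x)\<^sup>2 + y\<^sup>2)"
  have R: "R > 0" "R\<^sup>2 = (norm x)\<^sup>2 + y\<^sup>2" using y by (auto simp: R_def add_nonneg_pos)
  \<comment> \<open>Here the dimension enters: a Gaussian of width |t| in the plane contributes t^2.
    This makes the integral over t a second moment and leads to the cube of \<open>R\<close>, hence
    to the exponent 3/2 of the kernel.\<close>
  have gauss: "has_bochner_integral lborel (\<lambda>\<xi>::real^2. of_real (exp (- (pi * (norm \<xi> / t)\<^sup>2))) * cis (2 * pi * (x \<bullet> \<xi>)))
      (of_real (t\<^sup>2 * exp (- (pi * (norm x)\<^sup>2 * t\<^sup>2))))" if "t \<noteq> 0" for t and x :: "real^2"
  proof -
    have "1 / t\<^sup>2 > 0" using that by simp
    from has_bochner_integral_gaussian_cis[OF this, of x] show ?thesis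
      using that by (simp add: real_sqrt_divide power_divide power2_eq_square mult_ac)
  qed
  have [measurable]: "case_prod H \<in> borel_measurable (lborel \<Otimes>\<^sub>M lborel)"
    unfolding H_def by measurable
  have Heq: "H t \<xi> = of_real (y * exp (- pi * (t * y)\<^sup>2)) * (of_real (exp (- (pi * (norm \<xi> / t)\<^sup>2))) * cis (2 * pi * (x \<bullet> \<xi>)))" for t \<xi>
    by (simp add: H_def distrib_left right_diff_distrib flip: exp_add of_real_mult mult.assoc)
  have inner1: "has_bochner_integral lborel (H t) (of_real (y * t\<^sup>2 * exp (- (pi * (t * R)\<^sup>2))))" if "t \<noteq> 0" for t
  proof -
    have "y * exp (- pi * (t * y)\<^sup>2) * (t\<^sup>2 * exp (- (pi * (norm x)\<^sup>2 * t\<^sup>2))) = y * t\<^sup>2 * exp (- (pi * (t * R)\<^sup>2))"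
      by (simp add: power_mult_distrib R(2) algebra_simps flip: exp_add)
    moreover have "has_bochner_integral lborel (H t) (of_real (y * exp (- pi * (t * y)\<^sup>2)) * of_real (t\<^sup>2 * exp (- (pi * (norm x)\<^sup>2 * t\<^sup>2))))"
      unfolding Heq by (intro has_bochner_integral_mult_right gauss that)
    ultimately show ?thesis by (simp only: flip: of_real_mult)
  qed
  \<comment> \<open>Taking the modulus removes the character, which amounts to x = 0; accordingly
    \<open>R\<close> is replaced by \<open>y\<close>.\<close>
  have inner2: "has_bochner_integral lborel (\<lambda>\<xi>. norm (H t \<xi>)) (y * t\<^sup>2 * exp (- (pi * (t * y)\<^sup>2)))" if "t \<noteq> 0" for t
  proof -
    have "has_bochner_integral lborel (\<lambda>\<xi>::real^2. complex_of_real (exp (- (pi * (norm \<xi> / t)\<^sup>2)))) (complex_of_real (t\<^sup>2))"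
      using gauss[OF that, of 0] by simp
    then have "has_bochner_integral lborel (\<lambda>\<xi>::real^2. exp (- (pi * (norm \<xi> / t)\<^sup>2))) (t\<^sup>2)"
      by (simp only: has_bochner_integral_iff complex_of_real_integrable_eq integral_complex_of_real of_real_eq_iff)
    from has_bochner_integral_mult_right[OF this, of "y * exp (- pi * (t * y)\<^sup>2)"]
    show ?thesis using y by (simp add: Heq norm_mult abs_mult mult_ac)
  qed
  have int: "integrable (lborel \<Otimes>\<^sub>M lborel) (case_prod H)"
  proof (rule lborel_pair.Fubini_integrable)
    have "integrable lborel (\<lambda>t. y * t\<^sup>2 * exp (- (pi * (t * y)\<^sup>2)))"
      using has_bochner_integral_gaussian_square[OF y] by (auto simp: has_bochner_integral_iff)
    then show "integrable lborel (\<lambda>t. LINT \<xi>|lborel. norm (case (t, \<xi>) of (t, \<xi>) \<Rightarrow> H t \<xi>))"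
    proof (rule integrable_cong_AE[THEN iffD1, rotated -1])
      show "AE t in lborel. y * t\<^sup>2 * exp (- (pi * (t * y)\<^sup>2)) = (LINT \<xi>|lborel. norm (case (t, \<xi>) of (t, \<xi>) \<Rightarrow> H t \<xi>))"
        using AE_lborel_singleton[of 0] by eventually_elim (use inner2 in \<open>auto simp: has_bochner_integral_iff\<close>)
    qed measurable
    show "AE t in lborel. integrable lborel (\<lambda>\<xi>. case (t, \<xi>) of (t, \<xi>) \<Rightarrow> H t \<xi>)"
      using AE_lborel_singleton[of 0] by eventually_elim (use inner1 in \<open>auto simp: has_bochner_integral_iff\<close>)
  qed measurable
  \<comment> \<open>The subordination formula asks for \<rho> = norm \<xi> > 0, so the origin is
    left out as a null set.\<close>
  have AE2: "AE \<xi> in lborel. (LINT t|lborel. H t \<xi>) = of_real (exp (- (2 * pi * norm \<xi> * y))) * cis (2 * pi * (x \<bullet> \<xi>))"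
    using AE_lborel_singleton[of 0]
  proof eventually_elim
    case (elim \<xi>)
    then have "has_bochner_integral lborel (\<lambda>t. complex_of_real (y * exp (- pi * ((t * y)\<^sup>2 + (norm \<xi> / t)\<^sup>2)))) (of_real (exp (- (2 * pi * norm \<xi> * y))))"
      by (intro has_bochner_integral_of_real has_bochner_integral_cauchy_schloemilch y) auto
    from has_bochner_integral_mult_left[OF this, of "cis (2 * pi * (x \<bullet> \<xi>))"] show ?case by (simp add: H_def has_bochner_integral_iff)
  qed
  have "integrable lborel (\<lambda>\<xi>. LINT t|lborel. H t \<xi>)"
    using lborel_pair.integrable_snd[OF int] by simp
  then show "integrable lborel (\<lambda>\<xi>::real^2. of_real (exp (- (2 * pi * norm \<xi> * y))) * cis (2 * pi * (x \<bullet> \<xi>)))"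
    by (rule integrable_cong_AE[THEN iffD1, OF _ _ AE2, rotated -1]) measurable
  have "(LINT \<xi>|lborel. of_real (exp (- (2 * pi * norm \<xi> * y))) * cis (2 * pi * (x \<bullet> \<xi>))) = (LINT \<xi>|lborel. LINT t|lborel. H t \<xi>)"
    by (rule integral_cong_AE[OF _ _ AE2, symmetric]) measurable
  also have "\<dots> = (LINT t|lborel. LINT \<xi>|lborel. H t \<xi>)"
    by (rule lborel_pair.Fubini_integral[OF int])
  also have "\<dots> = (LINT t|lborel. of_real (y * t\<^sup>2 * exp (- (pi * (t * R)\<^sup>2))))"
  proof (rule integral_cong_AE)
    show "AE t in lborel. (LINT \<xi>|lborel. H t \<xi>) = of_real (y * t\<^sup>2 * exp (- (pi * (t * R)\<^sup>2)))"
      using AE_lborel_singleton[of 0] by eventually_elim (use inner1 in \<open>simp add: has_bochner_integral_iff\<close>)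
  qed measurable
  also have "\<dots> = of_real (y / (2 * pi * R ^ 3))"
    using has_bochner_integral_gaussian_square[OF R(1), of y] unfolding integral_complex_of_real by (simp only: has_bochner_integral_iff)
  also have "y / (2 * pi * R ^ 3) = poisson_kernel y x"
  proof -
    have "(R\<^sup>2) powr (3/2) = R ^ 3"
      using R(1) by (simp add: powr_powr flip: powr_numeral powr_realpow)
    then show ?thesis by (simp add: poisson_kernel_def R(2))
  qed
  finally show "of_real (poisson_kernel y x) = (LINT \<xi>|lborel. of_real (exp (- (2 * pi * norm \<xi> * y))) * cis (2 * pi * (x \<bullet> \<xi>)))" ..
qed

lemma integrable_exp_norm:
  assumes "c > 0"
  shows "integrable lborel (\<lambda>\<xi>::real^2. exp (- (c * norm \<xi>)))"
proof -
  have "integrable lborel (\<lambda>\<xi>::real^2. complex_of_real (exp (- (c * norm \<xi>))))"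
    using integrable_exp_norm_cis[of "c / (2 * pi)" 0] assms by (simp add: mult_ac)
  then show ?thesis by (simp only: complex_of_real_integrable_eq)
qed

subsection \<open>Polar coordinates in the plane\<close>

lemma vec2_eq_iff: "(v = w) \<longleftrightarrow> v $ 1 = w $ 1 \<and> v $ 2 = w $ (2::2)"
  by (simp add: vec_eq_iff forall_2)

lemma Basis_vec2: "(Basis :: (real^2) set) = {axis 1 1, axis 2 1}"
  by (auto simp: Basis_vec_def UNIV_2)

lemma continuous_on_vector2 [continuous_intros]:
  fixes f g :: "'a::topological_space \<Rightarrow> real"
  assumes "continuous_on A f" "continuous_on A g"
  shows "continuous_on A (\<lambda>x. vector [f x, g x] :: real^2)"
proof -
  have "(\<lambda>x. vector [f x, g x] :: real^2) = (\<lambda>x. \<chi> i. if i = 1 then f x else g x)"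
    by (auto simp: fun_eq_iff vec_eq_iff forall_2)
  moreover have "continuous_on A (\<lambda>x. if i = 1 then f x else g x)" for i :: 2
    using assms by (cases "i = 1") auto
  then have "continuous_on A (\<lambda>x. \<chi> i::2. if i = 1 then f x else g x)"
    by (rule continuous_on_vec_lambda)
  ultimately show ?thesis by (simp only:)
qed

lemma borel_measurable_vector2 [measurable (raw)]:
  assumes "f \<in> borel_measurable M" "g \<in> borel_measurable M"
  shows "(\<lambda>x. vector [f x, g x] :: real^2) \<in> borel_measurable M"
  using assms by (subst borel_measurable_euclidean_space) (simp add: Basis_vec2 inner_axis)

text \<open>Lebesgue measure is determined by its values on boxes, and there both measures give the
  product of the side lengths. This makes integrals over \<open>real^2\<close> accessible to
  Tonelli.\<close>

lemma lborel_vec2: "(lborel :: (real^2) measure) = distr (lborel \<Otimes>\<^sub>M lborel) borel (\<lambda>(a, b). vector [a, b])"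
proof (rule lborel_eqI)
  fix l u :: "real^2" assume lu: "\<And>b. b \<in> Basis \<Longrightarrow> l \<bullet> b \<le> u \<bullet> b"
  then have le: "l $ 1 \<le> u $ 1" "l $ 2 \<le> u $ 2" using lu[of "axis 1 1"] lu[of "axis 2 1"] by (simp_all add: Basis_vec2 inner_axis)
  have "(\<lambda>(a, b). vector [a, b]) -` box l u \<inter> space (lborel \<Otimes>\<^sub>M lborel) = {l $ 1<..<u $ 1} \<times> {l $ 2<..<u $ 2}"
    by (auto simp: box_def Basis_vec2 inner_axis space_pair_measure)
  then have "emeasure (distr (lborel \<Otimes>\<^sub>M lborel) borel (\<lambda>(a, b). vector [a, b])) (box l u) = emeasure (lborel \<Otimes>\<^sub>M lborel) ({l $ 1<..<u $ 1} \<times> {l $ 2<..<u $ 2})"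
    by (subst emeasure_distr) simp_all
  also have "\<dots> = ennreal (u $ 1 - l $ 1) * ennreal (u $ 2 - l $ 2)"
    using le by (subst lborel.emeasure_pair_measure_Times) auto
  also have "\<dots> = (\<Prod>b\<in>Basis. (u - l) \<bullet> b)"
    using le by (simp add: Basis_vec2 inner_axis axis_eq_axis ennreal_mult)
  finally show "emeasure (distr (lborel \<Otimes>\<^sub>M lborel) borel (\<lambda>(a, b). vector [a, b])) (box l u) = (\<Prod>b\<in>Basis. (u - l) \<bullet> b)" .
qed simp

lemma nn_integral_lborel_vec2:
  fixes F :: "real^2 \<Rightarrow> ennreal"
  assumes [measurable]: "F \<in> borel_measurable borel"
  shows "(\<integral>\<^sup>+p. F p \<partial>lborel) = (\<integral>\<^sup>+b. \<integral>\<^sup>+a. F (vector [a, b]) \<partial>lborel \<partial>lborel)"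
proof -
  have "(\<integral>\<^sup>+p. F p \<partial>lborel) = (\<integral>\<^sup>+z. F (case z of (a, b) \<Rightarrow> vector [a, b]) \<partial>(lborel \<Otimes>\<^sub>M lborel))"
    by (subst lborel_vec2, rule nn_integral_distr) simp_all
  also have "\<dots> = (\<integral>\<^sup>+b. \<integral>\<^sup>+a. F (vector [a, b]) \<partial>lborel \<partial>lborel)"
    by (subst lborel_pair.nn_integral_snd[symmetric]) simp_all
  finally show ?thesis .
qed

text \<open>Integrability of \<phi> is assumed because the change of variables theorem deals with
  absolutely integrable functions; the infinite case is reached later as a monotone limit.\<close>

lemma nn_integral_polar:
  fixes \<phi> :: "real^2 \<Rightarrow> real"
  assumes \<phi>: "integrable lborel \<phi>" and nonneg: "\<And>\<xi>. \<phi> \<xi> \<ge> 0"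
  shows "(\<integral>\<^sup>+\<theta>\<in>{0..<2 * pi}. (\<integral>\<^sup>+r\<in>{0..}. ennreal (r * \<phi> (vector [r * cos \<theta>, r * sin \<theta>])) \<partial>lborel) \<partial>lborel)
       = (\<integral>\<^sup>+\<xi>. ennreal (\<phi> \<xi>) \<partial>lborel)"
proof -
  \<comment> \<open>The coordinates of p are radius and angle. On the open strip \<open>S\<close>
    the polar map \<open>g\<close> is injective, and its image omits exactly the closed ray
    \<open>N\<close>, which is negligible.\<close>
  define S where "S = {p::real^2. 0 < p $ 1 \<and> 0 < p $ 2 \<and> p $ 2 < 2 * pi}"
  define N where "N = {\<xi>::real^2. \<xi> $ 2 = 0 \<and> 0 \<le> \<xi> $ 1}"
  define g where "g p = (vector [p $ 1 * cos (p $ 2), p $ 1 * sin (p $ 2)] :: real^2)" for p :: "real^2"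
  define g' where "g' p h = (vector [h $ 1 * cos (p $ 2) - p $ 1 * sin (p $ 2) * h $ 2, h $ 1 * sin (p $ 2) + p $ 1 * cos (p $ 2) * h $ 2] :: real^2)" for p h :: "real^2"
  have [measurable]: "\<phi> \<in> borel_measurable borel" using \<phi> by auto
  have "open S"
    unfolding S_def by (intro open_Collect_conj open_Collect_less continuous_intros)
  then have Sm: "S \<in> sets borel" by simp
  have "closed N"
    unfolding N_def by (intro closed_Collect_conj closed_Collect_le closed_Collect_eq continuous_intros)
  then have Nm: "- N \<in> sets borel" by auto
  have gS: "g ` S = - N"
  proof (intro equalityI subsetI)
    fix \<xi> assume "\<xi> \<in> g ` S"
    then obtain p where p: "p \<in> S" "\<xi> = g p" by auto
    show "\<xi> \<in> - N"
    proof
      assume "\<xi> \<in> N"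
      then have s: "sin (p $ 2) = 0" "cos (p $ 2) \<ge> 0"
        using p by (auto simp: N_def S_def g_def zero_le_mult_iff)
      have "p $ 2 = pi"
        using s(1) p(1) sin_gt_zero[of "p $ 2"] sin_lt_zero[of "p $ 2"] by (force simp: S_def)
      with s(2) show False by simp
    qed
  next
    fix \<xi> assume \<xi>: "\<xi> \<in> - N"
    define r where "r = sqrt ((\<xi> $ 1)\<^sup>2 + (\<xi> $ 2)\<^sup>2)"
    have "\<xi> $ 1 \<noteq> 0 \<or> \<xi> $ 2 \<noteq> 0" using \<xi> by (auto simp: N_def)
    then have r: "r > 0" "r\<^sup>2 = (\<xi> $ 1)\<^sup>2 + (\<xi> $ 2)\<^sup>2" by (auto simp: r_def sum_power2_gt_zero_iff)
    have "(\<xi> $ 1 / r)\<^sup>2 + (\<xi> $ 2 / r)\<^sup>2 = ((\<xi> $ 1)\<^sup>2 + (\<xi> $ 2)\<^sup>2) / r\<^sup>2"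
      by (simp add: power_divide add_divide_distrib)
    also have "\<dots> = 1" unfolding r(2)[symmetric] using r(1) by simp
    finally obtain t where t: "0 \<le> t" "t < 2 * pi" "\<xi> $ 1 / r = cos t" "\<xi> $ 2 / r = sin t"
      using sincos_total_2pi by metis
    then have eq: "\<xi> $ 1 = r * cos t" "\<xi> $ 2 = r * sin t" using r by (auto simp: field_simps)
    have "t \<noteq> 0" using eq \<xi> r by (auto simp: N_def)
    then show "\<xi> \<in> g ` S"
      using t r eq by (intro image_eqI[of _ _ "vector [r, t]"]) (auto simp: g_def S_def vec2_eq_iff)
  qed
  have inj: "inj_on g S"
  proof (rule inj_onI)
    fix p q assume pq: "p \<in> S" "q \<in> S" "g p = g q"
    have eq: "p $ 1 * cos (p $ 2) = q $ 1 * cos (q $ 2)" "p $ 1 * sin (p $ 2) = q $ 1 * sin (q $ 2)"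
      using pq(3) by (auto simp: g_def vec2_eq_iff)
    have sq: "(a * cos b)\<^sup>2 + (a * sin b)\<^sup>2 = a\<^sup>2" for a b :: real
      by (simp add: power_mult_distrib flip: distrib_left)
    have "(p $ 1)\<^sup>2 = (q $ 1)\<^sup>2" using sq eq by metis
    then have 1: "p $ 1 = q $ 1" using pq by (auto simp: S_def power2_eq_iff)
    then have "sin (p $ 2) = sin (q $ 2) \<and> cos (p $ 2) = cos (q $ 2)"
      using eq pq by (auto simp: S_def)
    then obtain n :: int where n: "p $ 2 = q $ 2 + 2 * pi * n" using sin_cos_eq_iff by auto
    then have "2 * pi * \<bar>real_of_int n\<bar> = \<bar>p $ 2 - q $ 2\<bar>" by (simp add: abs_mult)
    also have "\<dots> < 2 * pi * 1" using pq by (auto simp: S_def)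
    finally have "\<bar>real_of_int n\<bar> < 1" by (subst (asm) mult_less_cancel_left_pos) auto
    then have "n = 0" by linarith
    then show "p = q" using 1 n by (simp add: vec2_eq_iff)
  qed
  have der: "(g has_derivative g' p) (at p within S)" for p
  proof (subst has_derivative_componentwise_within, intro ballI)
    fix b :: "real^2" assume "b \<in> Basis"
    then have b: "b = axis 1 1 \<or> b = axis 2 1" by (simp add: Basis_vec2)
    have nth: "((\<lambda>x. x $ i) has_derivative (\<lambda>h. h $ i)) (at p within S)" for i
      by (intro bounded_linear_imp_has_derivative bounded_linear_vec_nth)
    have "((\<lambda>x. g x $ 1) has_derivative (\<lambda>h. g' p h $ 1)) (at p within S)"
         "((\<lambda>x. g x $ 2) has_derivative (\<lambda>h. g' p h $ 2)) (at p within S)"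
      unfolding g_def g'_def vector_2
      by (auto intro!: derivative_eq_intros nth simp: algebra_simps)
    then show "((\<lambda>x. g x \<bullet> b) has_derivative (\<lambda>h. g' p h \<bullet> b)) (at p within S)"
      using b by (auto simp: inner_axis)
  qed
  have det: "det (matrix (g' p)) = p $ 1" for p
  proof -
    have "det (matrix (g' p)) = p $ 1 * (cos (p $ 2) * cos (p $ 2)) + p $ 1 * (sin (p $ 2) * sin (p $ 2))"
      unfolding det_2 matrix_def g'_def by (simp add: axis_def algebra_simps)
    also have "\<dots> = p $ 1" unfolding distrib_left[symmetric] by (simp only: sin_cos_squared_add3 mult_1_right)
    finally show ?thesis .
  qed
  have neg: "negligible N"
    by (rule negligible_subset[OF negligible_standard_hyperplane_cart[of 2]]) (auto simp: N_def)
  have "integrable lebesgue \<phi>" using \<phi> by (simp add: integrable_completion)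
  then have "\<phi> absolutely_integrable_on UNIV" by (simp add: set_integrable_def)
  then have ai: "\<phi> absolutely_integrable_on g ` S"
    by (rule set_integrable_subset) (use Nm gS in auto)
  have "integral (g ` S) \<phi> = integral UNIV \<phi>"
    by (rule integral_subset_negligible) (use neg gS in \<open>auto simp: Compl_eq_Diff_UNIV[symmetric]\<close>)
  also have "\<dots> = (LINT \<xi>|lborel. \<phi> \<xi>)" using integral_lborel[OF \<phi>] by simp
  finally have val: "integral (g ` S) \<phi> = (LINT \<xi>|lborel. \<phi> \<xi>)" .
  \<comment> \<open>The multidimensional change of variables theorem concerns vector-valued
    functions; \<open>vec\<close> turns \<phi> into one with a single component.\<close>
  have "(\<lambda>p. \<bar>det (matrix (g' p))\<bar> *\<^sub>R (vec (\<phi> (g p)) :: real^1)) absolutely_integrable_on S \<and>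
      integral S (\<lambda>p. \<bar>det (matrix (g' p))\<bar> *\<^sub>R (vec (\<phi> (g p)) :: real^1)) = vec (LINT \<xi>|lborel. \<phi> \<xi>)"
    using ai val Sm
    by (intro has_absolute_integral_change_of_variables[where f="\<lambda>x. vec (\<phi> x)", THEN iffD2] der inj)
       (auto simp: absolutely_integrable_on_1_iff integral_on_1_eq)
  then have ai': "(\<lambda>p. \<bar>p $ 1\<bar> * \<phi> (g p)) absolutely_integrable_on S" 
    and val': "integral S (\<lambda>p. \<bar>p $ 1\<bar> * \<phi> (g p)) = (LINT \<xi>|lborel. \<phi> \<xi>)"
    by (simp_all add: absolutely_integrable_on_1_iff integral_on_1_eq det)
  have gm [measurable]: "g \<in> borel_measurable borel" unfolding g_def
    by (rule borel_measurable_continuous_onI) (intro continuous_intros)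
  let ?F = "\<lambda>p. indicator S p * (\<bar>p $ 1\<bar> * \<phi> (g p))"
  have [measurable]: "(\<lambda>p::real^2. p $ i) \<in> borel_measurable borel" for i
    by (rule borel_measurable_continuous_onI) (intro continuous_intros)
  have Fm [measurable]: "?F \<in> borel_measurable borel" using Sm by measurable
  have Fint: "integrable lborel ?F"
    using ai' by (simp add: set_integrable_def integrable_completion)
  have "(LINT p|lborel. ?F p) = (LINT \<xi>|lborel. \<phi> \<xi>)"
    using set_lebesgue_integral_eq_integral(2)[OF ai'] val'
    by (simp add: set_lebesgue_integral_def integral_completion)
  moreover have "(\<integral>\<^sup>+\<xi>. ennreal (\<phi> \<xi>) \<partial>lborel) = ennreal (LINT \<xi>|lborel. \<phi> \<xi>)"
    by (rule nn_integral_eq_integral[OF \<phi>]) (simp add: nonneg)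
  moreover have "(\<integral>\<^sup>+p. ennreal (?F p) \<partial>lborel) = ennreal (LINT p|lborel. ?F p)"
    by (rule nn_integral_eq_integral[OF Fint]) (simp add: nonneg)
  ultimately have "(\<integral>\<^sup>+\<xi>. ennreal (\<phi> \<xi>) \<partial>lborel) = (\<integral>\<^sup>+p. ennreal (?F p) \<partial>lborel)" by simp
  also have "\<dots> = (\<integral>\<^sup>+\<theta>. \<integral>\<^sup>+r. ennreal (?F (vector [r, \<theta>])) \<partial>lborel \<partial>lborel)"
    by (rule nn_integral_lborel_vec2) simp
  also have "\<dots> = (\<integral>\<^sup>+\<theta>\<in>{0..<2 * pi}. (\<integral>\<^sup>+r\<in>{0..}. ennreal (r * \<phi> (vector [r * cos \<theta>, r * sin \<theta>])) \<partial>lborel) \<partial>lborel)"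
  proof (rule nn_integral_cong_AE)
    \<comment> \<open>The angle 0 lies in the range of integration but not in \<open>S\<close>,
      hence the exceptional null set. The radius 0 needs none, since the factor r vanishes
      there.\<close>
    show "AE \<theta> in lborel. (\<integral>\<^sup>+r. ennreal (?F (vector [r, \<theta>])) \<partial>lborel) =
       (\<integral>\<^sup>+r\<in>{0..}. ennreal (r * \<phi> (vector [r * cos \<theta>, r * sin \<theta>])) \<partial>lborel) * indicator {0..<2 * pi} \<theta>"
      using AE_lborel_singleton[of "0::real"]
    proof eventually_elim
      case (elim \<theta>)
      then show ?case
        by (subst nn_integral_multc[symmetric])
           (auto simp: S_def g_def indicator_def intro!: nn_integral_cong)
    qed
  qed
  finally show ?thesis ..
qed

subsection \<open>Harmonic extension and Fourier transform\<close>

lemma has_vector_derivative_quotientI: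
  fixes f :: "real \<Rightarrow> 'a::real_normed_vector"
  assumes "((\<lambda>x. (f x - f y) /\<^sub>R (x - y)) \<longlongrightarrow> D) (at y)"
  shows "(f has_vector_derivative D) (at y)"
proof -
  have "((\<lambda>x. norm ((f x - f y) /\<^sub>R (x - y) - D)) \<longlongrightarrow> 0) (at y)"
    using assms by (simp add: tendsto_norm_zero_iff LIM_zero_iff)
  moreover have "\<forall>\<^sub>F x in at y. norm ((f x - f y) /\<^sub>R (x - y) - D) = norm ((f x - f y) - (x - y) *\<^sub>R D) / norm (x - y)"
    unfolding eventually_at_filter
  proof (intro always_eventually allI impI)
    fix x assume "x \<noteq> y"
    then have "(f x - f y) /\<^sub>R (x - y) - D = ((f x - f y) - (x - y) *\<^sub>R D) /\<^sub>R (x - y)"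
      by (simp add: scaleR_diff_right)
    then show "norm ((f x - f y) /\<^sub>R (x - y) - D) = norm ((f x - f y) - (x - y) *\<^sub>R D) / norm (x - y)"
      by (simp add: divide_inverse_commute)
  qed
  ultimately have "((\<lambda>x. norm ((f x - f y) - (x - y) *\<^sub>R D) / norm (x - y)) \<longlongrightarrow> 0) (at y)"
    by (rule Lim_transform_eventually)
  then show ?thesis
    unfolding has_vector_derivative_def has_derivative_iff_norm by (simp add: bounded_linear_scaleR_left)
qed

text \<open>Dominated convergence for difference quotients along a sequence eventually above y/2.
  Integrability is assumed at every positive height because the majorant lives at height y/4: part
  of the decay is spent on the factor \<open>a \<xi>\<close> produced by differentiation.\<close>

lemma has_vector_derivative_integral_exp_decay:
  fixes a :: "'a \<Rightarrow> real" and \<phi> :: "'a \<Rightarrow> complex"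
  assumes [measurable]: "a \<in> borel_measurable M" "\<phi> \<in> borel_measurable M"
    and a: "\<And>\<xi>. a \<xi> \<ge> 0"
    and int: "\<And>y. y > 0 \<Longrightarrow> integrable M (\<lambda>\<xi>. of_real (exp (- (a \<xi> * y))) * \<phi> \<xi>)"
    and y: "y > 0"
  shows "((\<lambda>y. LINT \<xi>|M. of_real (exp (- (a \<xi> * y))) * \<phi> \<xi>) has_vector_derivative
           (LINT \<xi>|M. of_real (- (a \<xi> * exp (- (a \<xi> * y)))) * \<phi> \<xi>)) (at y)"
proof -
  let ?f = "\<lambda>y. LINT \<xi>|M. of_real (exp (- (a \<xi> * y))) * \<phi> \<xi>"
  let ?D = "LINT \<xi>|M. of_real (- (a \<xi> * exp (- (a \<xi> * y)))) * \<phi> \<xi>"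
  have bound1: "\<bar>exp (- u) - exp (- v)\<bar> \<le> \<bar>u - v\<bar> * exp (- w)" if "w \<le> u" "w \<le> v" for u v w :: real
  proof -
    have *: "\<bar>exp (- u) - exp (- v)\<bar> \<le> (v - u) * exp (- w)" if "u \<le> v" "w \<le> u" for u v
    proof -
      have le: "1 - exp (u - v) \<le> v - u" using exp_ge_add_one_self[of "u - v"] by linarith
      have "exp (- v) = exp (- u) * exp (u - v)" by (simp flip: exp_add)
      then have "exp (- u) - exp (- v) = exp (- u) * (1 - exp (u - v))" by (simp add: algebra_simps)
      also have "\<dots> \<le> exp (- u) * (v - u)" using le by (intro mult_left_mono) simp_all
      also have "\<dots> \<le> exp (- w) * (v - u)" using that by (intro mult_right_mono) auto
      finally show ?thesis using that by (simp add: mult.commute)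
    qed
    show ?thesis using *[of u v] *[of v u] that by (cases "u \<le> v") (auto simp: abs_minus_commute)
  qed
  have "((\<lambda>x. (?f x - ?f y) /\<^sub>R (x - y)) \<longlongrightarrow> ?D) (at y)"
    unfolding tendsto_at_iff_sequentially comp_def
  proof (intro allI impI)
    fix X assume X: "\<forall>i. X i \<in> UNIV - {y}" "X \<longlonglongrightarrow> y"
    have "eventually (\<lambda>n. X n > y / 2) sequentially"
      using X(2) y by (intro order_tendstoD) auto
    then obtain m where m: "\<And>n. n \<ge> m \<Longrightarrow> X n > y / 2" by (auto simp: eventually_sequentially)
    define Y where "Y n = X (n + m)" for n
    have Y: "Y n > y / 2" "Y n \<noteq> y" for n using m X(1) by (auto simp: Y_def)
    have Ylim: "Y \<longlonglongrightarrow> y" unfolding Y_def using X(2) by (rule LIMSEQ_ignore_initial_segment)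
    have Yf: "(?f (Y n) - ?f y) /\<^sub>R (Y n - y) = (LINT \<xi>|M. of_real ((exp (- (a \<xi> * Y n)) - exp (- (a \<xi> * y))) / (Y n - y)) * \<phi> \<xi>)" for n
    proof -
      have "Y n > 0" using Y(1)[of n] y by linarith
      then have "?f (Y n) - ?f y = (LINT \<xi>|M. of_real (exp (- (a \<xi> * Y n))) * \<phi> \<xi> - of_real (exp (- (a \<xi> * y))) * \<phi> \<xi>)"
        by (intro Bochner_Integration.integral_diff[symmetric] int y)
      then have "(?f (Y n) - ?f y) /\<^sub>R (Y n - y) = (LINT \<xi>|M. of_real (inverse (Y n - y)) * (of_real (exp (- (a \<xi> * Y n))) * \<phi> \<xi> - of_real (exp (- (a \<xi> * y))) * \<phi> \<xi>))"
        unfolding scaleR_conv_of_real by (simp only: integral_mult_right_zero)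
      also have "\<dots> = (LINT \<xi>|M. of_real ((exp (- (a \<xi> * Y n)) - exp (- (a \<xi> * y))) / (Y n - y)) * \<phi> \<xi>)"
        by (intro Bochner_Integration.integral_cong refl) (simp add: algebra_simps divide_inverse)
      finally show ?thesis .
    qed
    have "(\<lambda>n. (?f (Y n) - ?f y) /\<^sub>R (Y n - y)) \<longlonglongrightarrow> ?D"
      unfolding Yf
    proof (rule integral_dominated_convergence[where w="\<lambda>\<xi>. 4 / y * norm (of_real (exp (- (a \<xi> * (y / 4)))) * \<phi> \<xi>)"])
      have D: "((\<lambda>x. (exp (- (c * x)) - exp (- (c * y))) / (x - y)) \<longlongrightarrow> - (c * exp (- (c * y)))) (at y)" for c
      proof -
        have "((\<lambda>x. exp (- (c * x))) has_field_derivative - (c * exp (- (c * y)))) (at y)"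
          by (auto intro!: derivative_eq_intros)
        then show ?thesis by (simp add: has_field_derivative_iff)
      qed
      have "(\<lambda>n. (exp (- (c * Y n)) - exp (- (c * y))) / (Y n - y)) \<longlonglongrightarrow> - (c * exp (- (c * y)))" for c
        using D[of c] Ylim Y(2) unfolding tendsto_at_iff_sequentially comp_def by blast
      then show "AE \<xi> in M. (\<lambda>n. of_real ((exp (- (a \<xi> * Y n)) - exp (- (a \<xi> * y))) / (Y n - y)) * \<phi> \<xi>) \<longlonglongrightarrow> of_real (- (a \<xi> * exp (- (a \<xi> * y)))) * \<phi> \<xi>"
        by (auto intro!: tendsto_mult tendsto_of_real simp del: of_real_minus of_real_mult of_real_divide of_real_diff)
      show "integrable M (\<lambda>\<xi>. 4 / y * norm (of_real (exp (- (a \<xi> * (y / 4)))) * \<phi> \<xi>))"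
        using y by (intro integrable_mult_right integrable_norm int) auto
      \<comment> \<open>Both exponents are at least c y/2. One half of this decay absorbs the
        Lipschitz factor c, by c y/4 \<le> exp(c y/4); the other half remains as the
        majorant.\<close>
      have b: "\<bar>(exp (- (c * Y n)) - exp (- (c * y))) / (Y n - y)\<bar> \<le> 4 / y * exp (- (c * (y / 4)))" if "c \<ge> 0" for c n
      proof -
        have le: "c * (y / 4) \<le> exp (c * (y / 4))" using exp_ge_add_one_self[of "c * (y / 4)"] by linarith
        have "\<bar>exp (- (c * Y n)) - exp (- (c * y))\<bar> \<le> \<bar>c * Y n - c * y\<bar> * exp (- (c * (y / 2)))"
          using Y(1)[of n] y that by (intro bound1 mult_left_mono) auto
        also have "\<bar>c * Y n - c * y\<bar> = c * \<bar>Y n - y\<bar>"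
          using that by (simp add: abs_mult flip: right_diff_distrib)
        finally have "\<bar>(exp (- (c * Y n)) - exp (- (c * y))) / (Y n - y)\<bar> \<le> c * exp (- (c * (y / 2)))"
          using Y(2)[of n] by (simp add: abs_divide field_simps)
        also have "\<dots> = 4 / y * (c * (y / 4)) * exp (- (c * (y / 2)))" using y by simp
        also have "\<dots> \<le> 4 / y * exp (c * (y / 4)) * exp (- (c * (y / 2)))"
          using y le by (intro mult_right_mono mult_left_mono) simp_all
        also have "\<dots> = 4 / y * exp (- (c * (y / 4)))"
          by (simp add: field_simps flip: exp_add)
        finally show ?thesis .
      qed
      show "AE \<xi> in M. norm (of_real ((exp (- (a \<xi> * Y n)) - exp (- (a \<xi> * y))) / (Y n - y)) * \<phi> \<xi>) \<le> 4 / y * norm (of_real (exp (- (a \<xi> * (y / 4)))) * \<phi> \<xi>)" for n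
        unfolding norm_mult norm_of_real
        using mult_right_mono[OF b[OF a] norm_ge_zero] by (auto simp: mult.assoc)
    qed measurable
    then show "(\<lambda>n. (?f (X n) - ?f y) /\<^sub>R (X n - y)) \<longlonglongrightarrow> ?D"
      unfolding Y_def by (rule LIMSEQ_offset)
  qed
  then show ?thesis by (rule has_vector_derivative_quotientI)
qed

section \<open>Exponential decay on the half-line\<close>

text \<open>Half of the exponential absorbs the linear factor, by s \<le> exp s at s = c t /
  2.\<close>

lemma mult_exp_le:
  fixes c t :: real
  assumes "c > 0" "t \<ge> 0"
  shows "t * exp (- (c * t)) \<le> 2 / c * exp (- (c / 2 * t))"
proof -
  have "c / 2 * t \<le> exp (c / 2 * t)" using exp_ge_add_one_self[of "c / 2 * t"] by linarith
  then have "2 / c * (c / 2 * t) * exp (- (c * t)) \<le> 2 / c * exp (c / 2 * t) * exp (- (c * t))"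
    using assms by (intro mult_right_mono mult_left_mono) simp_all
  then show ?thesis using assms by (simp add: mult.assoc flip: exp_add)
qed

lemma nn_integral_exp_decay:
  fixes c :: real
  assumes "c > 0"
  shows "(\<integral>\<^sup>+x\<in>{0..}. ennreal (exp (- (c * x))) \<partial>lborel) = ennreal (1 / c)"
proof -
  have "((\<lambda>x. - exp (- (c * x)) / c) \<longlongrightarrow> 0) at_top"
  proof -
    have "filterlim (\<lambda>x. c * x) at_top at_top"
      using assms by (intro filterlim_tendsto_pos_mult_at_top[OF tendsto_const]) (auto simp: filterlim_ident)
    then have "((\<lambda>x. exp (- (c * x))) \<longlongrightarrow> 0) at_top"
      by (intro filterlim_compose[OF exp_at_bot]) (simp add: filterlim_uminus_at_top)
    from tendsto_divide[OF tendsto_minus[OF this] tendsto_const[of c]] assms show ?thesis by simp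
  qed
  then have "(\<integral>\<^sup>+x\<in>{0..}. ennreal (exp (- (c * x))) \<partial>lborel) = ennreal (0 - (- exp (- (c * 0)) / c))"
    using assms by (intro nn_integral_FTC_atLeast) (auto intro!: derivative_eq_intros)
  then show ?thesis using assms by simp
qed

lemma integrable_exp_decay:
  fixes c :: real
  assumes "c > 0"
  shows "integrable lborel (\<lambda>x. indicator {0..} x * exp (- (c * x)))"
proof (rule integrableI_nonneg)
  have "(\<integral>\<^sup>+x. ennreal (indicator {0..} x * exp (- (c * x))) \<partial>lborel) = (\<integral>\<^sup>+x\<in>{0..}. ennreal (exp (- (c * x))) \<partial>lborel)"
    by (intro nn_integral_cong) (auto simp: indicator_def)
  then show "(\<integral>\<^sup>+x. ennreal (indicator {0..} x * exp (- (c * x))) \<partial>lborel) < \<infinity>"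
    using nn_integral_exp_decay[OF assms] by simp
qed auto

section \<open>The square of the Hardy norm\<close>

text \<open>The square is a double supremum of products \<open>f i * f j\<close>, each at most the
  larger of the two squares. This brings the square of the Hardy norm inside its supremum over
  heights.\<close>

lemma SUP_power2_ennreal:
  fixes f :: "'i \<Rightarrow> ennreal"
  shows "(SUP i\<in>I. f i)\<^sup>2 = (SUP i\<in>I. (f i)\<^sup>2)"
proof (rule antisym)
  have "(SUP i\<in>I. f i)\<^sup>2 = (SUP i\<in>I. SUP j\<in>I. f i * f j)"
    by (simp add: power2_eq_square SUP_mult_left_ennreal SUP_mult_right_ennreal) (rule SUP_commute)
  also have "\<dots> \<le> (SUP i\<in>I. (f i)\<^sup>2)"
  proof (intro SUP_least)
    fix i j assume ij: "i \<in> I" "j \<in> I"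
    show "f i * f j \<le> (SUP i\<in>I. (f i)\<^sup>2)"
    proof (cases "f i \<le> f j")
      case True
      then have "f i * f j \<le> (f j)\<^sup>2" by (auto simp: power2_eq_square intro: mult_right_mono)
      then show ?thesis using SUP_upper[OF ij(2), of "\<lambda>i. (f i)\<^sup>2"] by (rule order_trans)
    next
      case False
      then have "f i * f j \<le> (f i)\<^sup>2" by (auto simp: power2_eq_square intro: mult_left_mono)
      then show ?thesis using SUP_upper[OF ij(1), of "\<lambda>i. (f i)\<^sup>2"] by (rule order_trans)
    qed
  qed
  finally show "(SUP i\<in>I. f i)\<^sup>2 \<le> (SUP i\<in>I. (f i)\<^sup>2)" .
  show "(SUP i\<in>I. (f i)\<^sup>2) \<le> (SUP i\<in>I. f i)\<^sup>2"
    by (intro SUP_least power_mono SUP_upper) auto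
qed

lemma L2_enorm_power2: "(L2_enorm g)\<^sup>2 = (\<integral>\<^sup>+x. ennreal ((norm (g x))\<^sup>2) \<partial>lborel)"
proof (cases "(\<integral>\<^sup>+x. ennreal ((norm (g x))\<^sup>2) \<partial>lborel) = top")
  case True
  then show ?thesis by (simp add: L2_enorm_def Let_def power2_eq_square)
next
  case False
  then show ?thesis
    by (simp add: L2_enorm_def Let_def ennreal_power ennreal_enn2real_if)
qed

lemma hardy2_norm_power2:
  "(hardy2_norm F)\<^sup>2 = (SUP y\<in>{0<..}. \<integral>\<^sup>+x. ennreal ((norm (F (Complex x y)))\<^sup>2) \<partial>lborel)"
  by (simp add: hardy2_norm_def SUP_power2_ennreal L2_enorm_power2)

lemma norm_polar [simp]: "norm (vector [r * cos \<theta>, r * sin \<theta>] :: real^2) = \<bar>r\<bar>"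
proof -
  have "(r * cos \<theta>)\<^sup>2 + (r * sin \<theta>)\<^sup>2 = r\<^sup>2"
    by (simp add: power_mult_distrib flip: distrib_left)
  then show ?thesis by (simp add: norm_vec_def L2_set_def sum_2)
qed

section \<open>Fourier transform and Poisson extension of an integrable function\<close>

text \<open>A Lebesgue measurable function agrees almost everywhere with a Borel one. Both
  \<open>fourier_transform f\<close> and \<open>poisson_extension f\<close> are integrals of
  \<open>f\<close> against Borel functions, so \<open>f\<close> may be replaced in them by the same
  \<open>g\<close>.\<close>

lemma lebesgue_integral_borel_representative:
  fixes f :: "'a::euclidean_space \<Rightarrow> complex"
  assumes f: "integrable lebesgue f"
  obtains g where "integrable lborel g"
    and "\<And>h. h \<in> borel_measurable borel \<Longrightarrow> (LINT x|lebesgue. f x * h x) = (LINT x|lborel. g x * h x)"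
proof -
  have fm: "f \<in> borel_measurable lebesgue" using f by (rule borel_measurable_integrable)
  then have "(\<lambda>x. Re (f x)) \<in> borel_measurable lebesgue" "(\<lambda>x. Im (f x)) \<in> borel_measurable lebesgue"
    by (auto intro: borel_measurable_continuous_on[where f=Re] borel_measurable_continuous_on[where f=Im] continuous_intros)
  then obtain p q where [measurable]: "p \<in> borel_measurable lborel" "q \<in> borel_measurable lborel"
    and pq: "AE x in lborel. Re (f x) = p x" "AE x in lborel. Im (f x) = q x"
    using completion_ex_borel_measurable_real by metis
  define g where "g x = of_real (p x) + \<i> * of_real (q x)" for x
  have [measurable]: "g \<in> borel_measurable borel" unfolding g_def by measurable
  have "AE x in lborel. f x = g x"
    using pq by eventually_elim (auto simp: g_def complex_eq_iff)
  then have AE: "AE x in lebesgue. f x = g x" by (rule AE_completion)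
  have "integrable lebesgue g"
    by (rule integrable_cong_AE[THEN iffD1, OF fm _ AE f]) (auto intro: measurable_completion)
  then have 1: "integrable lborel g" by (simp add: integrable_completion)
  have 2: "(LINT x|lebesgue. f x * h x) = (LINT x|lborel. g x * h x)" if [measurable]: "h \<in> borel_measurable borel" for h
  proof -
    have "h \<in> borel_measurable lebesgue" "g \<in> borel_measurable lebesgue" by (auto intro: measurable_completion)
    then have "(LINT x|lebesgue. f x * h x) = (LINT x|lebesgue. g x * h x)"
      using fm AE by (intro integral_cong_AE) auto
    also have "\<dots> = (LINT x|lborel. g x * h x)" by (rule integral_completion) measurable
    finally show ?thesis .
  qed
  show ?thesis using that 1 2 by blast
qed

lemma continuous_poisson_kernel:
  assumes "y > 0"
  shows "continuous_on UNIV (poisson_kernel y)"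
proof -
  have "(norm x)\<^sup>2 + y\<^sup>2 \<noteq> 0" for x :: "real^2" using assms by (simp add: sum_power2_eq_zero_iff)
  then show ?thesis unfolding poisson_kernel_def by (intro continuous_intros) simp_all
qed

text \<open>The three claims share one Borel representative \<open>g\<close>. For the last, the
  kernel is replaced by its Fourier integral and the order of integration is exchanged; the majorant
  is |g(t)| exp(-2 pi |\<xi>| y).\<close>

lemma
  fixes f :: "real^2 \<Rightarrow> complex"
  assumes f: "integrable lebesgue f"
  shows continuous_fourier_transform: "continuous_on UNIV (fourier_transform f)"
    and bounded_fourier_transform: "\<exists>N. \<forall>\<xi>. norm (fourier_transform f \<xi>) \<le> N"
    and poisson_extension_eq: "y > 0 \<Longrightarrow> poisson_extension f x y =
      (LINT \<xi>|lborel. of_real (exp (- (2 * pi * norm \<xi> * y))) * (cis (2 * pi * (x \<bullet> \<xi>)) * fourier_transform f \<xi>))"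
proof -
  obtain g where g: "integrable lborel g"
    and rep: "\<And>h. h \<in> borel_measurable borel \<Longrightarrow> (LINT x|lebesgue. f x * h x) = (LINT x|lborel. g x * h x)"
    using lebesgue_integral_borel_representative[OF f] by blast
  have [measurable]: "g \<in> borel_measurable borel" using g by auto
  have ft: "fourier_transform f \<xi> = (LINT t|lborel. g t * cis (2 * pi * (- \<xi> \<bullet> t)))" for \<xi>
  proof -
    have "exp (- 2 * \<i> * of_real pi * of_real (x \<bullet> \<xi>)) = cis (2 * pi * (- \<xi> \<bullet> x))" for x
      by (simp add: cis_conv_exp inner_commute mult_ac)
    then have "fourier_transform f \<xi> = (LINT x|lebesgue. f x * cis (2 * pi * (- \<xi> \<bullet> x)))"
      unfolding fourier_transform_def by simp
    also have "\<dots> = (LINT t|lborel. g t * cis (2 * pi * (- \<xi> \<bullet> t)))" by (rule rep) measurable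
    finally show ?thesis .
  qed
  show "continuous_on UNIV (fourier_transform f)"
    unfolding ft
    by (rule continuous_on_compose2[OF continuous_on_integral_cis[OF g], of UNIV uminus]) (auto intro: continuous_intros)
  have "norm (fourier_transform f \<xi>) \<le> (LINT t|lborel. norm (g t))" for \<xi>
    unfolding ft by (rule order_trans[OF integral_norm_bound]) (simp add: norm_mult)
  then show "\<exists>N. \<forall>\<xi>. norm (fourier_transform f \<xi>) \<le> N" by blast
  assume y: "y > 0"
  have "(\<lambda>t. poisson_kernel y (x - t)) \<in> borel_measurable borel"
    by (rule borel_measurable_continuous_onI)
       (rule continuous_on_compose2[OF continuous_poisson_kernel[OF y]], auto intro: continuous_intros)
  then have "poisson_extension f x y = (LINT t|lborel. g t * of_real (poisson_kernel y (x - t)))"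
    unfolding poisson_extension_def by (intro rep) measurable
  also have "\<dots> = (LINT t|lborel. LINT \<xi>|lborel. g t * (of_real (exp (- (2 * pi * norm \<xi> * y))) * cis (2 * pi * ((x - t) \<bullet> \<xi>))))"
    by (simp only: poisson_kernel_eq[OF y] integral_mult_right_zero)
  also have "\<dots> = (LINT \<xi>|lborel. LINT t|lborel. g t * (of_real (exp (- (2 * pi * norm \<xi> * y))) * cis (2 * pi * ((x - t) \<bullet> \<xi>))))"
    by (rule lborel_pair.Fubini_integral[symmetric],
        rule integrable_pair_bound[OF integrable_norm[OF g] integrable_exp_norm[of "2 * pi * y"]])
       (use y in \<open>auto simp: norm_mult mult_ac\<close>)
  also have "\<dots> = (LINT \<xi>|lborel. of_real (exp (- (2 * pi * norm \<xi> * y))) * (cis (2 * pi * (x \<bullet> \<xi>)) * fourier_transform f \<xi>))"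
  proof (rule Bochner_Integration.integral_cong[OF refl])
    fix \<xi> :: "real^2"
    have "cis (2 * pi * ((x - t) \<bullet> \<xi>)) = cis (2 * pi * (x \<bullet> \<xi>)) * cis (2 * pi * (- \<xi> \<bullet> t))" for t
      by (simp add: cis_mult inner_diff_left inner_diff_right inner_commute right_diff_distrib)
    then have "g t * (of_real (exp (- (2 * pi * norm \<xi> * y))) * cis (2 * pi * ((x - t) \<bullet> \<xi>))) =
       (of_real (exp (- (2 * pi * norm \<xi> * y))) * cis (2 * pi * (x \<bullet> \<xi>))) * (g t * cis (2 * pi * (- \<xi> \<bullet> t)))" for t
      by (simp only: mult_ac)
    then show "(LINT t|lborel. g t * (of_real (exp (- (2 * pi * norm \<xi> * y))) * cis (2 * pi * ((x - t) \<bullet> \<xi>)))) =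
       of_real (exp (- (2 * pi * norm \<xi> * y))) * (cis (2 * pi * (x \<bullet> \<xi>)) * fourier_transform f \<xi>)"
      unfolding ft by (simp only: integral_mult_right_zero mult.assoc)
  qed
  finally show "poisson_extension f x y =
      (LINT \<xi>|lborel. of_real (exp (- (2 * pi * norm \<xi> * y))) * (cis (2 * pi * (x \<bullet> \<xi>)) * fourier_transform f \<xi>))" .
qed

lemma integrable_exp_norm_bounded:
  fixes \<phi> :: "real^2 \<Rightarrow> complex"
  assumes c: "c > 0" and [measurable]: "\<phi> \<in> borel_measurable borel" and bdd: "\<And>\<xi>. norm (\<phi> \<xi>) \<le> N"
  shows "integrable lborel (\<lambda>\<xi>. of_real (norm \<xi> * exp (- (c * norm \<xi>))) * \<phi> \<xi>)"
proof (rule Bochner_Integration.integrable_bound)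
  show "integrable lborel (\<lambda>\<xi>::real^2. 2 / c * exp (- (c / 2 * norm \<xi>)) * N)"
    using integrable_exp_norm[of "c / 2"] c by (intro integrable_mult_left integrable_mult_right) auto
  have N: "N \<ge> 0" using bdd[of 0] norm_ge_zero order_trans by blast
  show "AE \<xi> in lborel. norm (of_real (norm \<xi> * exp (- (c * norm \<xi>))) * \<phi> \<xi>) \<le> norm (2 / c * exp (- (c / 2 * norm \<xi>)) * N)"
  proof (rule AE_I2)
    fix \<xi> :: "real^2"
    have "norm (of_real (norm \<xi> * exp (- (c * norm \<xi>))) * \<phi> \<xi>) = norm \<xi> * exp (- (c * norm \<xi>)) * norm (\<phi> \<xi>)"
      by (simp add: norm_mult)
    also have "\<dots> \<le> 2 / c * exp (- (c / 2 * norm \<xi>)) * N"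
      using c by (intro mult_mono mult_exp_le bdd) auto
    also have "\<dots> = norm (2 / c * exp (- (c / 2 * norm \<xi>)) * N)" using c N by simp
    finally show "norm (of_real (norm \<xi> * exp (- (c * norm \<xi>))) * \<phi> \<xi>) \<le> norm (2 / c * exp (- (c / 2 * norm \<xi>)) * N)" .
  qed
qed measurable

subsection \<open>The two sides of the identity\<close>

lemma nn_integral_weighted_exp_decay:
  fixes \<rho> B :: real
  assumes "\<rho> \<ge> 0" "B \<ge> 0"
  shows "(\<integral>\<^sup>+y\<in>{0<..}. ennreal ((2 * pi * \<rho> * exp (- (2 * pi * \<rho> * y)) * B)\<^sup>2) \<partial>lborel) = ennreal (pi * (\<rho> * B\<^sup>2))"
\<comment> \<open>At \<rho> = 0 there is no decay to integrate, but the factor \<rho> makes both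
  sides vanish.\<close>
proof (cases "\<rho> = 0")
  case False
  then have \<rho>: "\<rho> > 0" using assms by simp
  have eq: "(2 * pi * \<rho> * exp (- (2 * pi * \<rho> * y)) * B)\<^sup>2 = (2 * pi * \<rho> * B)\<^sup>2 * exp (- (4 * pi * \<rho> * y))" for y
    by (simp add: power_mult_distrib flip: exp_double)
  have "(\<integral>\<^sup>+y\<in>{0<..}. ennreal ((2 * pi * \<rho> * exp (- (2 * pi * \<rho> * y)) * B)\<^sup>2) \<partial>lborel) =
        (\<integral>\<^sup>+y. ennreal ((2 * pi * \<rho> * B)\<^sup>2) * (ennreal (exp (- (4 * pi * \<rho> * y))) * indicator {0..} y) \<partial>lborel)"
  proof (rule nn_integral_cong_AE)
    show "AE y in lborel. ennreal ((2 * pi * \<rho> * exp (- (2 * pi * \<rho> * y)) * B)\<^sup>2) * indicator {0<..} y =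
        ennreal ((2 * pi * \<rho> * B)\<^sup>2) * (ennreal (exp (- (4 * pi * \<rho> * y))) * indicator {0..} y)"
      using AE_lborel_singleton[of "0::real"]
      by eventually_elim (auto simp: eq ennreal_mult indicator_def)
  qed
  also have "\<dots> = ennreal ((2 * pi * \<rho> * B)\<^sup>2) * ennreal (1 / (4 * pi * \<rho>))"
    using \<rho> by (simp add: nn_integral_cmult nn_integral_exp_decay)
  also have "\<dots> = ennreal ((2 * pi * \<rho> * B)\<^sup>2 * (1 / (4 * pi * \<rho>)))"
    using \<rho> by (intro ennreal_mult[symmetric]) auto
  also have "(2 * pi * \<rho> * B)\<^sup>2 * (1 / (4 * pi * \<rho>)) = pi * (\<rho> * B\<^sup>2)"
    using \<rho> by (simp add: power2_eq_square)
  finally show ?thesis .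
qed simp

text \<open>For fixed y > 0 the exponential makes \<open>h y\<close> integrable although \<phi> is
  merely bounded, so Plancherel applies in x. Tonelli then puts the integral over y inside, where it
  is explicit for each \<xi>.\<close>

lemma nn_integral_harmonic_extension_derivative:
  fixes \<phi> :: "real^2 \<Rightarrow> complex"
  assumes cont: "continuous_on UNIV \<phi>" and bdd: "\<And>\<xi>. norm (\<phi> \<xi>) \<le> N"
  shows "(\<integral>\<^sup>+y\<in>{0<..}. (\<integral>\<^sup>+x. ennreal ((norm (LINT \<xi>|lborel.
            of_real (- (2 * pi * norm \<xi> * exp (- (2 * pi * norm \<xi> * y)))) * (cis (2 * pi * (x \<bullet> \<xi>)) * \<phi> \<xi>)))\<^sup>2) \<partial>lborel) \<partial>lborel)
       = ennreal pi * (\<integral>\<^sup>+\<xi>. ennreal (norm \<xi> * (norm (\<phi> \<xi>))\<^sup>2) \<partial>lborel)"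
proof -
  have [measurable]: "\<phi> \<in> borel_measurable borel" using cont by (rule borel_measurable_continuous_onI)
  have N: "N \<ge> 0" using bdd[of 0] norm_ge_zero order_trans by blast
  define V where "V x y = (LINT \<xi>|lborel.
            of_real (- (2 * pi * norm \<xi> * exp (- (2 * pi * norm \<xi> * y)))) * (cis (2 * pi * (x \<bullet> \<xi>)) * \<phi> \<xi>))" for x y
  define h where "h y \<xi> = of_real (- (2 * pi * norm \<xi> * exp (- (2 * pi * norm \<xi> * y)))) * \<phi> \<xi>" for y \<xi>
  have plan: "(\<integral>\<^sup>+x. ennreal ((norm (V x y))\<^sup>2) \<partial>lborel)
     = (\<integral>\<^sup>+\<xi>. ennreal ((2 * pi * norm \<xi> * exp (- (2 * pi * norm \<xi> * y)) * norm (\<phi> \<xi>))\<^sup>2) \<partial>lborel)" if y: "y > 0" for y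
  proof -
    have heq: "h y = (\<lambda>\<xi>. of_real (- 2 * pi) * (of_real (norm \<xi> * exp (- (2 * pi * y * norm \<xi>))) * \<phi> \<xi>))"
      by (auto simp: h_def fun_eq_iff mult_ac)
    have "integrable lborel (h y)"
      unfolding heq using y by (intro integrable_mult_right integrable_exp_norm_bounded[OF _ _ bdd]) auto
    moreover have "continuous_on UNIV (h y)" unfolding h_def by (intro continuous_intros cont)
    moreover have "norm (h y \<xi>) \<le> 2 * pi * (2 / (2 * pi * y) * 1) * N" for \<xi>
    proof -
      have "norm (h y \<xi>) = 2 * pi * (norm \<xi> * exp (- (2 * pi * y * norm \<xi>))) * norm (\<phi> \<xi>)"
        unfolding heq by (simp add: norm_mult)
      also have "\<dots> \<le> 2 * pi * (2 / (2 * pi * y) * exp (- (2 * pi * y / 2 * norm \<xi>))) * N"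
        using y by (intro mult_mono mult_left_mono mult_exp_le bdd) auto
      also have "\<dots> \<le> 2 * pi * (2 / (2 * pi * y) * 1) * N"
        using y N by (intro mult_right_mono mult_left_mono) auto
      finally show ?thesis .
    qed
    ultimately have "(\<integral>\<^sup>+x. ennreal ((norm (LINT \<xi>|lborel. h y \<xi> * cis (2 * pi * (x \<bullet> \<xi>))))\<^sup>2) \<partial>lborel)
       = (\<integral>\<^sup>+\<xi>. ennreal ((norm (h y \<xi>))\<^sup>2) \<partial>lborel)"
      by (rule plancherel)
    moreover have "norm (h y \<xi>) = 2 * pi * norm \<xi> * exp (- (2 * pi * norm \<xi> * y)) * norm (\<phi> \<xi>)" for \<xi>
      by (simp add: h_def norm_mult)
    moreover have "h y \<xi> * cis (2 * pi * (x \<bullet> \<xi>)) = of_real (- (2 * pi * norm \<xi> * exp (- (2 * pi * norm \<xi> * y)))) * (cis (2 * pi * (x \<bullet> \<xi>)) * \<phi> \<xi>)" for x \<xi>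
      by (simp add: h_def mult_ac)
    ultimately show ?thesis unfolding V_def by (simp only:)
  qed
  have "(\<integral>\<^sup>+y\<in>{0<..}. (\<integral>\<^sup>+x. ennreal ((norm (V x y))\<^sup>2) \<partial>lborel) \<partial>lborel)
     = (\<integral>\<^sup>+y. (\<integral>\<^sup>+\<xi>. ennreal ((2 * pi * norm \<xi> * exp (- (2 * pi * norm \<xi> * y)) * norm (\<phi> \<xi>))\<^sup>2) * indicator {0<..} y \<partial>lborel) \<partial>lborel)"
    by (rule nn_integral_cong) (simp add: plan indicator_def)
  also have "\<dots> = (\<integral>\<^sup>+\<xi>. (\<integral>\<^sup>+y\<in>{0<..}. ennreal ((2 * pi * norm \<xi> * exp (- (2 * pi * norm \<xi> * y)) * norm (\<phi> \<xi>))\<^sup>2) \<partial>lborel) \<partial>lborel)"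
    by (rule lborel_pair.Fubini') measurable
  also have "\<dots> = (\<integral>\<^sup>+\<xi>. ennreal pi * ennreal (norm \<xi> * (norm (\<phi> \<xi>))\<^sup>2) \<partial>lborel)"
    by (simp only: nn_integral_weighted_exp_decay norm_ge_zero ennreal_mult[OF pi_ge_zero mult_nonneg_nonneg] zero_le_power2)
  also have "\<dots> = ennreal pi * (\<integral>\<^sup>+\<xi>. ennreal (norm \<xi> * (norm (\<phi> \<xi>))\<^sup>2) \<partial>lborel)"
    by (rule nn_integral_cmult) measurable
  finally show ?thesis unfolding V_def .
qed

text \<open>One factor r is kept in front on the right: it is the Jacobian in
  \<open>nn_integral_polar\<close>, while the other becomes \<open>norm \<xi>\<close>.\<close>

lemma plancherel_F_slice:
  fixes f :: "real^2 \<Rightarrow> complex"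
  assumes f: "integrable lebesgue f" and y: "y > 0"
  shows "(\<integral>\<^sup>+x. ennreal ((norm (F_slice f \<theta> (Complex x y)))\<^sup>2) \<partial>lborel) =
    (\<integral>\<^sup>+r\<in>{0..}. ennreal (r * (r * exp (- (4 * pi * y * r)) * (norm (fourier_transform f (vector [r * cos \<theta>, r * sin \<theta>])))\<^sup>2)) \<partial>lborel)"
proof -
  \<comment> \<open>Plancherel needs a function continuous on the whole line. The weight r vanishes
    at 0, so the extension by zero to r < 0 is continuous, and \<open>max r 0\<close> expresses it
    without a case distinction.\<close>
  define q where "q r = of_real (max r 0 * exp (- (2 * pi * y * max r 0))) *
     fourier_transform f (vector [max r 0 * cos \<theta>, max r 0 * sin \<theta>])" for r
  obtain N where N: "\<And>\<xi>. norm (fourier_transform f \<xi>) \<le> N" using bounded_fourier_transform[OF f] by blast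
  have N0: "N \<ge> 0" using N[of 0] norm_ge_zero order_trans by blast
  have cont: "continuous_on UNIV q"
    unfolding q_def
    by (intro continuous_intros continuous_on_compose2[OF continuous_fourier_transform[OF f]]) auto
  then have [measurable]: "q \<in> borel_measurable borel" by (rule borel_measurable_continuous_onI)
  have qbound: "norm (q r) \<le> 2 / (2 * pi * y) * exp (- (2 * pi * y / 2 * max r 0)) * N" for r
  proof -
    have "norm (q r) = max r 0 * exp (- (2 * pi * y * max r 0)) * norm (fourier_transform f (vector [max r 0 * cos \<theta>, max r 0 * sin \<theta>]))"
      by (simp add: q_def norm_mult)
    also have "\<dots> \<le> 2 / (2 * pi * y) * exp (- (2 * pi * y / 2 * max r 0)) * N"
      using y by (intro mult_mono mult_exp_le N) auto
    finally show ?thesis .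
  qed
  have "integrable lborel q"
  proof (rule Bochner_Integration.integrable_bound)
    show "integrable lborel (\<lambda>r. 2 / (2 * pi * y) * N * (indicator {0..} r * exp (- (2 * pi * y / 2 * r))))"
      using y by (intro integrable_mult_right integrable_exp_decay) auto
    show "AE r in lborel. norm (q r) \<le> norm (2 / (2 * pi * y) * N * (indicator {0..} r * exp (- (2 * pi * y / 2 * r))))"
    proof (rule AE_I2)
      fix r
      show "norm (q r) \<le> norm (2 / (2 * pi * y) * N * (indicator {0..} r * exp (- (2 * pi * y / 2 * r))))"
        using qbound[of r] y N0 by (cases "r \<ge> 0") (auto simp: q_def max_def mult_ac)
    qed
  qed simp
  moreover have "norm (q r) \<le> 2 / (2 * pi * y) * 1 * N" for r
    by (rule order_trans[OF qbound]) (use y N0 in \<open>intro mult_right_mono mult_left_mono, auto\<close>)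
  ultimately have "(\<integral>\<^sup>+x. ennreal ((norm (LINT r|lborel. q r * cis (2 * pi * (x \<bullet> r))))\<^sup>2) \<partial>lborel) = (\<integral>\<^sup>+r. ennreal ((norm (q r))\<^sup>2) \<partial>lborel)"
    using cont by (intro plancherel)
  moreover have "F_slice f \<theta> (Complex x y) = (LINT r|lborel. q r * cis (2 * pi * (x \<bullet> r)))" for x
    unfolding F_slice_def set_lebesgue_integral_def
  proof (rule Bochner_Integration.integral_cong[OF refl])
    fix r
    have "2 * \<i> * of_real pi * of_real r * Complex x y = of_real (- (2 * pi * y * r)) + \<i> * of_real (2 * pi * (x * r))"
      by (simp add: complex_eq_iff algebra_simps)
    then have "exp (2 * \<i> * of_real pi * of_real r * Complex x y) = of_real (exp (- (2 * pi * y * r))) * cis (2 * pi * (x * r))"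
      by (simp only: exp_add cis_conv_exp exp_of_real)
    then show "indicator {0..} r *\<^sub>R (exp (2 * \<i> * of_real pi * of_real r * Complex x y) *
        fourier_transform f (vector [r * cos \<theta>, r * sin \<theta>]) * of_real r) = q r * cis (2 * pi * (x \<bullet> r))"
      by (simp add: q_def max_def indicator_def mult_ac)
  qed
  moreover have "(\<integral>\<^sup>+r. ennreal ((norm (q r))\<^sup>2) \<partial>lborel) =
     (\<integral>\<^sup>+r\<in>{0..}. ennreal (r * (r * exp (- (4 * pi * y * r)) * (norm (fourier_transform f (vector [r * cos \<theta>, r * sin \<theta>])))\<^sup>2)) \<partial>lborel)"
  proof (rule nn_integral_cong)
    fix r :: real
    have "(exp (- (2 * pi * y * r)))\<^sup>2 = exp (- (4 * pi * y * r))" by (simp flip: exp_double)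
    then show "ennreal ((norm (q r))\<^sup>2) = ennreal (r * (r * exp (- (4 * pi * y * r)) * (norm (fourier_transform f (vector [r * cos \<theta>, r * sin \<theta>])))\<^sup>2)) * indicator {0..} r"
      by (cases "r \<ge> 0") (auto simp: q_def norm_mult power_mult_distrib max_def indicator_def power2_eq_square[of r])
  qed
  ultimately show ?thesis by simp
qed

text \<open>Since \<open>I y \<theta>\<close> increases as y decreases, the supremum over all
  heights equals the one over the sequence \<open>e n\<close>. A countable increasing supremum may
  be exchanged with the integral over \<theta>, which an uncountable one does not allow in
  general.\<close>

lemma nn_integral_hardy2_norm_F_slice:
  fixes f :: "real^2 \<Rightarrow> complex"
  assumes f: "integrable lebesgue f"
  shows "(\<integral>\<^sup>+\<theta>\<in>{0..<2 * pi}. (hardy2_norm (F_slice f \<theta>))\<^sup>2 \<partial>lborel)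
       = (\<integral>\<^sup>+\<xi>. ennreal (norm \<xi> * (norm (fourier_transform f \<xi>))\<^sup>2) \<partial>lborel)"
proof -
  let ?F = "fourier_transform f"
  have cont: "continuous_on UNIV ?F" by (rule continuous_fourier_transform[OF f])
  then have [measurable]: "?F \<in> borel_measurable borel" by (rule borel_measurable_continuous_onI)
  obtain N where N: "\<And>\<xi>. norm (?F \<xi>) \<le> N" using bounded_fourier_transform[OF f] by blast
  define e where "e n = 1 / real (Suc n)" for n
  have e: "e n > 0" for n by (simp add: e_def)
  have edec: "e n \<le> e m" if "m \<le> n" for m n using that by (simp add: e_def frac_le)
  have elim: "e \<longlonglongrightarrow> 0" unfolding e_def by (rule lim_1_over_n[THEN LIMSEQ_Suc])
  define \<phi> where "\<phi> y \<xi> = norm \<xi> * exp (- (4 * pi * y * norm \<xi>)) * (norm (?F \<xi>))\<^sup>2" for y and \<xi> :: "real^2"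
  have [measurable]: "\<phi> y \<in> borel_measurable borel" for y unfolding \<phi>_def by measurable
  have \<phi>0: "\<phi> y \<xi> \<ge> 0" for y \<xi> by (simp add: \<phi>_def)
  have \<phi>mono: "\<phi> y \<xi> \<le> \<phi> y' \<xi>" if "y' \<le> y" for y y' \<xi>
    unfolding \<phi>_def using that by (intro mult_right_mono mult_left_mono) (auto intro!: mult_right_mono)
  have \<phi>int: "integrable lborel (\<phi> y)" if y: "y > 0" for y
  proof -
    have "norm (complex_of_real ((norm (?F \<xi>))\<^sup>2)) \<le> N\<^sup>2" for \<xi>
      using power_mono[OF N norm_ge_zero] by (simp add: norm_power)
    then have "integrable lborel (\<lambda>\<xi>. of_real (norm \<xi> * exp (- (4 * pi * y * norm \<xi>))) * complex_of_real ((norm (?F \<xi>))\<^sup>2))"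
      using y by (intro integrable_exp_norm_bounded) auto
    then have "integrable lborel (\<lambda>\<xi>. complex_of_real (\<phi> y \<xi>))" by (simp add: \<phi>_def)
    then show ?thesis by (simp only: complex_of_real_integrable_eq)
  qed
  define I where "I y \<theta> = (\<integral>\<^sup>+r\<in>{0..}. ennreal (r * \<phi> y (vector [r * cos \<theta>, r * sin \<theta>])) \<partial>lborel)" for y \<theta>
  have Im [measurable]: "I y \<in> borel_measurable borel" for y unfolding I_def by measurable
  have Imono: "I y \<theta> \<le> I y' \<theta>" if "y' \<le> y" for y y' \<theta>
    unfolding I_def
    by (intro nn_integral_mono) (auto simp: indicator_def intro!: ennreal_leI mult_left_mono \<phi>mono that)
  have hardy: "(hardy2_norm (F_slice f \<theta>))\<^sup>2 = (SUP n. I (e n) \<theta>)" for \<theta>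
  proof -
    have "(hardy2_norm (F_slice f \<theta>))\<^sup>2 = (SUP y\<in>{0<..}. I y \<theta>)"
      unfolding hardy2_norm_power2
    proof (rule SUP_cong[OF refl])
      fix y :: real assume "y \<in> {0<..}"
      then show "(\<integral>\<^sup>+x. ennreal ((norm (F_slice f \<theta> (Complex x y)))\<^sup>2) \<partial>lborel) = I y \<theta>"
        unfolding I_def \<phi>_def
        by (subst plancherel_F_slice[OF f]) (auto simp: indicator_def intro!: nn_integral_cong)
    qed
    also have "\<dots> = (SUP n. I (e n) \<theta>)"
    proof (rule antisym)
      show "(SUP y\<in>{0<..}. I y \<theta>) \<le> (SUP n. I (e n) \<theta>)"
      proof (rule SUP_least)
        fix y :: real assume "y \<in> {0<..}"
        then obtain n where "e n < y" using reals_Archimedean[of y] by (auto simp: e_def divide_inverse)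
        then show "I y \<theta> \<le> (SUP n. I (e n) \<theta>)" by (intro SUP_upper2[of n]) (auto intro!: Imono)
      qed
      show "(SUP n. I (e n) \<theta>) \<le> (SUP y\<in>{0<..}. I y \<theta>)"
        using e by (intro SUP_least SUP_upper) auto
    qed
    finally show ?thesis .
  qed
  have "(\<integral>\<^sup>+\<theta>\<in>{0..<2 * pi}. (hardy2_norm (F_slice f \<theta>))\<^sup>2 \<partial>lborel) = (\<integral>\<^sup>+\<theta>. (SUP n. I (e n) \<theta> * indicator {0..<2 * pi} \<theta>) \<partial>lborel)"
    by (simp add: hardy SUP_mult_right_ennreal)
  also have "\<dots> = (SUP n. \<integral>\<^sup>+\<theta>\<in>{0..<2 * pi}. I (e n) \<theta> \<partial>lborel)"
    by (rule nn_integral_monotone_convergence_SUP)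
       (auto simp: incseq_def le_fun_def intro!: mult_right_mono Imono edec)
  \<comment> \<open>Polar coordinates are used before the limit, because integrability of
    \<open>\<phi> y\<close> is available for y > 0 only.\<close>
  also have "\<dots> = (SUP n. \<integral>\<^sup>+\<xi>. ennreal (\<phi> (e n) \<xi>) \<partial>lborel)"
    unfolding I_def by (simp only: nn_integral_polar[OF \<phi>int[OF e] \<phi>0])
  also have "\<dots> = (\<integral>\<^sup>+\<xi>. ennreal (norm \<xi> * (norm (?F \<xi>))\<^sup>2) \<partial>lborel)"
  proof (rule LIMSEQ_unique[OF LIMSEQ_SUP])
    show "incseq (\<lambda>n. \<integral>\<^sup>+\<xi>. ennreal (\<phi> (e n) \<xi>) \<partial>lborel)"
      by (auto simp: incseq_def intro!: nn_integral_mono ennreal_leI \<phi>mono edec)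
    show "(\<lambda>n. \<integral>\<^sup>+\<xi>. ennreal (\<phi> (e n) \<xi>) \<partial>lborel) \<longlonglongrightarrow> (\<integral>\<^sup>+\<xi>. ennreal (norm \<xi> * (norm (?F \<xi>))\<^sup>2) \<partial>lborel)"
    proof (rule nn_integral_LIMSEQ)
      show "incseq (\<lambda>n \<xi>. ennreal (\<phi> (e n) \<xi>))"
        by (auto simp: incseq_def le_fun_def intro!: ennreal_leI \<phi>mono edec)
      have "(\<lambda>n. \<phi> (e n) \<xi>) \<longlonglongrightarrow> norm \<xi> * exp (- (4 * pi * 0 * norm \<xi>)) * (norm (?F \<xi>))\<^sup>2" for \<xi>
        unfolding \<phi>_def by (intro tendsto_intros elim)
      then show "(\<lambda>n. ennreal (\<phi> (e n) \<xi>)) \<longlonglongrightarrow> ennreal (norm \<xi> * (norm (?F \<xi>))\<^sup>2)" for \<xi>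
        by (intro tendsto_ennrealI) simp
    qed measurable
  qed
  finally show ?thesis .
qed

lemma vector_derivative_poisson_extension:
  fixes f :: "real^2 \<Rightarrow> complex"
  assumes f: "integrable lebesgue f" and y: "y > 0"
  shows "vector_derivative (\<lambda>y. poisson_extension f x y) (at y) = (LINT \<xi>|lborel.
           of_real (- (2 * pi * norm \<xi> * exp (- (2 * pi * norm \<xi> * y)))) * (cis (2 * pi * (x \<bullet> \<xi>)) * fourier_transform f \<xi>))"
proof (rule vector_derivative_at)
  obtain N where N: "\<And>\<xi>. norm (fourier_transform f \<xi>) \<le> N" using bounded_fourier_transform[OF f] by blast
  have [measurable]: "fourier_transform f \<in> borel_measurable borel"
    using continuous_fourier_transform[OF f] by (rule borel_measurable_continuous_onI)
  have "((\<lambda>y. LINT \<xi>|lborel. of_real (exp (- (2 * pi * norm \<xi> * y))) * (cis (2 * pi * (x \<bullet> \<xi>)) * fourier_transform f \<xi>)) has_vector_derivative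
     (LINT \<xi>|lborel. of_real (- (2 * pi * norm \<xi> * exp (- (2 * pi * norm \<xi> * y)))) * (cis (2 * pi * (x \<bullet> \<xi>)) * fourier_transform f \<xi>))) (at y)"
  proof (rule has_vector_derivative_integral_exp_decay[OF _ _ _ _ y])
    fix y :: real assume y: "y > 0"
    show "integrable lborel (\<lambda>\<xi>. of_real (exp (- (2 * pi * norm \<xi> * y))) * (cis (2 * pi * (x \<bullet> \<xi>)) * fourier_transform f \<xi>))"
    proof (rule Bochner_Integration.integrable_bound)
      show "integrable lborel (\<lambda>\<xi>::real^2. exp (- (2 * pi * y * norm \<xi>)) * N)"
        using y by (intro integrable_mult_left integrable_exp_norm) auto
      show "AE \<xi> in lborel. norm (of_real (exp (- (2 * pi * norm \<xi> * y))) * (cis (2 * pi * (x \<bullet> \<xi>)) * fourier_transform f \<xi>)) \<le> norm (exp (- (2 * pi * y * norm \<xi>)) * N)"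
        by (intro AE_I2) (auto simp: norm_mult abs_mult mult_ac intro!: mult_left_mono order_trans[OF N abs_ge_self])
    qed measurable
  qed auto
  \<comment> \<open>The Fourier formula for the extension holds for positive heights, so the
    derivative is transferred on the open half-line around y.\<close>
  then show "((\<lambda>y. poisson_extension f x y) has_vector_derivative
     (LINT \<xi>|lborel. of_real (- (2 * pi * norm \<xi> * exp (- (2 * pi * norm \<xi> * y)))) * (cis (2 * pi * (x \<bullet> \<xi>)) * fourier_transform f \<xi>))) (at y)"
    by (rule has_vector_derivative_transform_within_open[where S="{0<..}"])
       (use y in \<open>auto simp: poisson_extension_eq[OF f]\<close>)
qed

theorem mainTheorem3:
  fixes f :: "real^2 \<Rightarrow> complex"
  assumes "integrable lebesgue f"
  shows "(\<integral>\<^sup>+\<theta>\<in>{0..<2 * pi}. (hardy2_norm (F_slice f \<theta>))\<^sup>2 \<partial>lborel)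
    = ennreal (1 / pi) *
      (\<integral>\<^sup>+p\<in>upper_half_space.
         ennreal ((norm (vector_derivative (\<lambda>y. poisson_extension f (fst p) y) (at (snd p))))\<^sup>2)
       \<partial>lborel)"
proof -
  let ?F = "fourier_transform f"
  \<comment> \<open>\<open>V\<close> replaces the derivative on the half-space pointwise, which
    requires no measurability. Tonelli is then applied to \<open>V\<close>, whose joint
    measurability follows from the integral formula.\<close>
  define V where "V x y = (LINT \<xi>|lborel.
     of_real (- (2 * pi * norm \<xi> * exp (- (2 * pi * norm \<xi> * y)))) * (cis (2 * pi * (x \<bullet> \<xi>)) * ?F \<xi>))" for x y
  obtain N where N: "\<And>\<xi>. norm (?F \<xi>) \<le> N" using bounded_fourier_transform[OF assms] by blast
  note cont = continuous_fourier_transform[OF assms]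
  have [measurable]: "?F \<in> borel_measurable borel"
    using cont by (rule borel_measurable_continuous_onI)
  have Vm [measurable]: "(\<lambda>z. V (fst z) (snd z)) \<in> borel_measurable (lborel \<Otimes>\<^sub>M lborel)"
    unfolding V_def by measurable
  have "(\<integral>\<^sup>+p\<in>upper_half_space. ennreal ((norm (vector_derivative (\<lambda>y. poisson_extension f (fst p) y) (at (snd p))))\<^sup>2) \<partial>lborel)
      = (\<integral>\<^sup>+p. ennreal ((norm (V (fst p) (snd p)))\<^sup>2) * indicator {0<..} (snd p) \<partial>(lborel \<Otimes>\<^sub>M lborel))"
    unfolding lborel_prod
    by (intro nn_integral_cong)
       (auto simp: upper_half_space_def indicator_def V_def vector_derivative_poisson_extension[OF assms])
  also have "\<dots> = (\<integral>\<^sup>+y. (\<integral>\<^sup>+x. ennreal ((norm (V x y))\<^sup>2) * indicator {0<..} y \<partial>lborel) \<partial>lborel)"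
    by (subst lborel_pair.nn_integral_snd[symmetric]) simp_all
  also have "\<dots> = (\<integral>\<^sup>+y\<in>{0<..}. (\<integral>\<^sup>+x. ennreal ((norm (V x y))\<^sup>2) \<partial>lborel) \<partial>lborel)"
    by (intro nn_integral_cong) (simp add: indicator_def)
  also have "\<dots> = ennreal pi * (\<integral>\<^sup>+\<xi>. ennreal (norm \<xi> * (norm (?F \<xi>))\<^sup>2) \<partial>lborel)"
    unfolding V_def by (rule nn_integral_harmonic_extension_derivative[OF cont N])
  finally show ?thesis
    unfolding nn_integral_hardy2_norm_F_slice[OF assms]
    by (simp add: mult.assoc[symmetric] flip: ennreal_mult)
qed

end
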